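(* Let $k$ be an infinite field, let $0<r<m\le n$ be integers, and suppose that i) $r=1$, or ii) $r=m-1$, or iii) $r=m-2$. Let $\Omega=\bigcup_{j\in[n]}\omega_j\times\{j\}\subset[m]\times[n]$ with $\omega_j\subset[m]$ and $\#\Omega=r(m+n-r)$. Then the following two conditions are equivalent: (a) there is a partition $[n]=\bigcup_{\ell\in[r]}\mathcal{J}_\ell$ such that $\Omega_{\mathcal{J}_\ell}$ is a relaxed $(1,r,m)$-SLMF for every $\ell\in[r]$; (b) $\Omega$ is a relaxed $(r,r,m)$-SLMF. Moreover, in these cases these conditions characterize the algebraic matroid of $\mathrm{M}(r,m\times n)$: an $\Omega$ with $\#\Omega=r(m+n-r)$ is a base of the algebraic matroid of $\mathrm{M}(r,m\times n)$ if and only if it satisfies (a), equivalently (b).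
   Context: Notation: $[s]=\{1,\dots,s\}$; $\#$ denotes cardinality. $Z=(z_{ij})_{(i,j)\in[m]\times[n]}$ is an $m\times n$ matrix of independent variables over $k$, $k[Z]$ is the polynomial ring in these variables, and $I_{r+1}(Z)$ is the (prime) ideal generated by all $(r+1)\times(r+1)$ minors of $Z$. The determinantal variety is $\mathrm{M}(r,m\times n)=\operatorname{Spec}k[Z]/I_{r+1}(Z)$, an integral scheme of dimension $r(m+n-r)$. Algebraic matroid of $\mathrm{M}(r,m\times n)$: its ground set is $[m]\times[n]$; a subset $\Omega\subset[m]\times[n]$ is independent if the images in $k[Z]/I_{r+1}(Z)$ of the $z_{ij}$ with $(i,j)\in\Omega$ are algebraically independent over $k$. A base (or base set) is a maximal independent set; every base has cardinality $r(m+n-r)$. For $\mathcal{J}\subset[n]$ put $\Omega_{\mathcal{J}}=\bigcup_{j\in\mathcal{J}}\omega_j\times\{j\}$ (so $\Omega=\Omega_{[n]}$). For a positive integer $\nu$, $\Omega_{\mathcal{J}}$ is called a relaxed $(\nu,r,m)$-SLMF if $$\sum_{j\in\mathcal{J}}\max\{\#(\omega_j\cap\mathcal{I})-r,\,0\}\le\nu(\#\mathcal{I}-r)$$ for every $\mathcal{I}\subset[m]$ with $\#\mathcal{I}\ge r+1$, with equality for $\mathcal{I}=[m]$. *)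

theory Defs
  imports
    "HOL-Library.Poly_Mapping"
    "HOL-Library.Disjoint_Sets"
    "HOL-Algebra.QuotRing"
    "HOL-Algebra.FiniteProduct"
    "Jordan_Normal_Form.Determinant"
    "Jordan_Normal_Form.DL_Submatrix"
begin

text \<open>
  Indices are 0-based: \<open>{..<s}\<close> plays the role of \<open>[s] = {1,\<dots>,s}\<close>.
\<close>

type_synonym ('v, 'k) mpoly = "('v \<Rightarrow>\<^sub>0 nat) \<Rightarrow>\<^sub>0 'k"

definition mpoly_const :: "'k::field \<Rightarrow> ('v, 'k) mpoly" where
  "mpoly_const c = Poly_Mapping.single 0 c"

definition mpoly_var :: "'v \<Rightarrow> ('v, 'k::field) mpoly" where
  "mpoly_var v = Poly_Mapping.single (Poly_Mapping.single v 1) 1"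

text \<open>The type supplies a variable for every element of \<open>'v\<close>; the carrier keeps
  only the polynomials in the variables from \<open>V\<close>.\<close>

definition mpoly_ring :: "'v set \<Rightarrow> ('v, 'k::field) mpoly ring" where
  "mpoly_ring V = \<lparr>carrier = {p. \<forall>t \<in> Poly_Mapping.keys p. Poly_Mapping.keys t \<subseteq> V},
     monoid.mult = (*), one = 1, zero = 0, add = (+)\<rparr>"

text \<open>Value of \<open>p\<close> in the commutative ring \<open>A\<close> at the point \<open>x\<close>; \<open>\<phi>\<close> is the
  structure map \<open>k \<rightarrow> A\<close>.\<close>

definition mpoly_eval ::
  "('a, 'b) ring_scheme \<Rightarrow> ('k::field \<Rightarrow> 'a) \<Rightarrow> ('v \<Rightarrow> 'a) \<Rightarrow> ('v, 'k) mpoly \<Rightarrow> 'a" where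
  "mpoly_eval A \<phi> x p =
     (\<Oplus>\<^bsub>A\<^esub> t \<in> Poly_Mapping.keys p. \<phi> (Poly_Mapping.lookup p t) \<otimes>\<^bsub>A\<^esub>
        (\<Otimes>\<^bsub>A\<^esub> v \<in> Poly_Mapping.keys t. x v [^]\<^bsub>A\<^esub> Poly_Mapping.lookup t v))"

definition algebraically_independent ::
  "('a, 'b) ring_scheme \<Rightarrow> ('k::field \<Rightarrow> 'a) \<Rightarrow> ('v \<Rightarrow> 'a) \<Rightarrow> 'v set \<Rightarrow> bool" where
  "algebraically_independent A \<phi> x S \<longleftrightarrow>
     (\<forall>p \<in> carrier (mpoly_ring S). mpoly_eval A \<phi> x p = \<zero>\<^bsub>A\<^esub> \<longrightarrow> p = 0)"

lemma mpoly_ring_carrier_iff: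
  "p \<in> carrier (mpoly_ring V) \<longleftrightarrow> (\<forall>t \<in> Poly_Mapping.keys p. Poly_Mapping.keys t \<subseteq> V)"
  by (simp add: mpoly_ring_def)

lemma mpoly_ring_simps [simp]:
  "monoid.mult (mpoly_ring V) = (*)" "one (mpoly_ring V) = 1"
  "zero (mpoly_ring V) = 0" "add (mpoly_ring V) = (+)"
  by (simp_all add: mpoly_ring_def)

lemma mpoly_ring_add_closed:
  assumes "p \<in> carrier (mpoly_ring V)" "q \<in> carrier (mpoly_ring V)"
  shows "p + q \<in> carrier (mpoly_ring V)"
  using assms Poly_Mapping.keys_add[of p q] unfolding mpoly_ring_carrier_iff by blast

lemma mpoly_ring_mult_closed:
  assumes "p \<in> carrier (mpoly_ring V)" "q \<in> carrier (mpoly_ring V)"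
  shows "p * q \<in> carrier (mpoly_ring V)"
  unfolding mpoly_ring_carrier_iff
proof
  fix t assume "t \<in> Poly_Mapping.keys (p * q)"
  then obtain a b where "t = a + b" "a \<in> Poly_Mapping.keys p" "b \<in> Poly_Mapping.keys q"
    using Poly_Mapping.keys_mult[of p q] by blast
  then show "Poly_Mapping.keys t \<subseteq> V"
    using assms Poly_Mapping.keys_add[of a b] unfolding mpoly_ring_carrier_iff by blast
qed

lemma cring_mpoly_ring: "cring (mpoly_ring V :: ('v, 'k::field) mpoly ring)"
proof (rule cringI)
  show "abelian_group (mpoly_ring V :: ('v, 'k) mpoly ring)"
  proof (rule abelian_groupI)
    fix p :: "('v, 'k) mpoly"
    assume "p \<in> carrier (mpoly_ring V)"
    then show "\<exists>q \<in> carrier (mpoly_ring V). q \<oplus>\<^bsub>mpoly_ring V\<^esub> p = \<zero>\<^bsub>mpoly_ring V\<^esub>"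
      by (intro bexI[of _ "- p"]) (auto simp: mpoly_ring_carrier_iff)
  qed (simp_all add: mpoly_ring_add_closed mpoly_ring_carrier_iff[of 0] add.assoc add.commute)
  show "comm_monoid (mpoly_ring V :: ('v, 'k) mpoly ring)"
    by (rule comm_monoidI)
      (simp_all add: mpoly_ring_mult_closed mpoly_ring_carrier_iff[of 1] mult.assoc mult.commute)
qed (simp add: distrib_right)

definition generic_mat :: "nat \<Rightarrow> nat \<Rightarrow> (nat \<times> nat, 'k::field) mpoly mat" where
  "generic_mat m n = mat m n mpoly_var"

definition minors :: "nat \<Rightarrow> 'a::comm_ring_1 mat \<Rightarrow> 'a set" where
  "minors s A = {det (submatrix A I J) | I J.
     I \<subseteq> {..<dim_row A} \<and> J \<subseteq> {..<dim_col A} \<and> card I = s \<and> card J = s}"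

definition det_poly_ring :: "nat \<Rightarrow> nat \<Rightarrow> (nat \<times> nat, 'k::field) mpoly ring" where
  "det_poly_ring m n = mpoly_ring ({..<m} \<times> {..<n})"

lemma minors_generic_mat_subset:
  "minors s (generic_mat m n) \<subseteq> carrier (det_poly_ring m n :: (nat \<times> nat, 'k::field) mpoly ring)"
proof
  let ?C = "carrier (det_poly_ring m n :: (nat \<times> nat, 'k) mpoly ring)"
  have zero: "0 \<in> ?C" and one: "1 \<in> ?C"
    by (simp_all add: det_poly_ring_def mpoly_ring_carrier_iff)
  have add: "p + q \<in> ?C" and mult: "p * q \<in> ?C" if "p \<in> ?C" "q \<in> ?C" for p q
    using that by (simp_all add: det_poly_ring_def mpoly_ring_add_closed mpoly_ring_mult_closed)
  have uminus: "- p \<in> ?C" if "p \<in> ?C" for p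
    using that by (simp add: det_poly_ring_def mpoly_ring_carrier_iff)
  have sum: "sum f S \<in> ?C" if "\<And>x. x \<in> S \<Longrightarrow> f x \<in> ?C" for f :: "'x \<Rightarrow> _" and S
    using that by (induction S rule: infinite_finite_induct) (auto intro: zero add)
  have prod: "prod f S \<in> ?C" if "\<And>x. x \<in> S \<Longrightarrow> f x \<in> ?C" for f :: "nat \<Rightarrow> _" and S
    using that by (induction S rule: infinite_finite_induct) (auto intro: one mult)
  fix d :: "(nat \<times> nat, 'k) mpoly"
  assume "d \<in> minors s (generic_mat m n)"
  then obtain I J where d: "d = det (submatrix (generic_mat m n) I J)"
    and IJ: "I \<subseteq> {..<m}" "J \<subseteq> {..<n}" "card I = s" "card J = s"
    unfolding minors_def by (auto simp: generic_mat_def)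
  let ?S = "submatrix (generic_mat m n :: (nat \<times> nat, 'k) mpoly mat) I J"
  have eqs: "{i. i < m \<and> i \<in> I} = I" "{j. j < n \<and> j \<in> J} = J"
    using IJ by auto
  have sub: "?S =
      mat s s (\<lambda>(a, b). generic_mat m n $$ (pick I a, pick J b))"
    by (simp add: submatrix_def generic_mat_def eqs IJ)
  have entry: "?S $$ (a, b) \<in> ?C" if "a < s" "b < s" for a b
  proof -
    have "pick I a \<in> I" "pick J b \<in> J"
      using that IJ by (auto intro: pick_in_set_le)
    then have "pick I a < m" "pick J b < n"
      using IJ by auto
    then show ?thesis
      using that unfolding sub
      by (simp add: generic_mat_def mpoly_var_def det_poly_ring_def mpoly_ring_carrier_iff)
  qed
  have "signof p \<in> ?C" for p :: "nat \<Rightarrow> nat"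
    by (cases "evenperm p") (auto simp: sign_def intro: one uminus)
  moreover have "(\<Prod>i = 0..<s. ?S $$ (i, p i)) \<in> ?C"
    if "p permutes {0..<s}" for p
    using that by (intro prod entry) (auto simp: permutes_in_image)
  ultimately have "(\<Sum>p\<in>{p. p permutes {0..<s}}. signof p *
      (\<Prod>i = 0..<s. ?S $$ (i, p i))) \<in> ?C"
    by (intro sum mult) auto
  moreover have "?S \<in> carrier_mat s s"
    unfolding sub by simp
  ultimately show "d \<in> ?C"
    by (simp add: d det_def'[of _ s])
qed

definition det_ideal :: "nat \<Rightarrow> nat \<Rightarrow> nat \<Rightarrow> (nat \<times> nat, 'k::field) mpoly set" where
  "det_ideal r m n = Idl\<^bsub>det_poly_ring m n\<^esub> (minors (r + 1) (generic_mat m n))"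

definition det_coord_ring :: "nat \<Rightarrow> nat \<Rightarrow> nat \<Rightarrow> (nat \<times> nat, 'k::field) mpoly set ring" where
  "det_coord_ring r m n = det_poly_ring m n Quot det_ideal r m n"

definition det_residue ::
  "nat \<Rightarrow> nat \<Rightarrow> nat \<Rightarrow> (nat \<times> nat, 'k::field) mpoly \<Rightarrow> (nat \<times> nat, 'k) mpoly set" where
  "det_residue r m n p = det_ideal r m n +>\<^bsub>det_poly_ring m n\<^esub> p"

definition det_matroid_indep ::
  "'k::field itself \<Rightarrow> nat \<Rightarrow> nat \<Rightarrow> nat \<Rightarrow> (nat \<times> nat) set \<Rightarrow> bool" where
  "det_matroid_indep (_ :: 'k itself) r m n \<Omega> \<longleftrightarrow>
     \<Omega> \<subseteq> {..<m} \<times> {..<n} \<and>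
     algebraically_independent (det_coord_ring r m n)
       (\<lambda>c :: 'k. det_residue r m n (mpoly_const c))
       (\<lambda>z. det_residue r m n (mpoly_var z)) \<Omega>"

definition det_matroid_base ::
  "'k::field itself \<Rightarrow> nat \<Rightarrow> nat \<Rightarrow> nat \<Rightarrow> (nat \<times> nat) set \<Rightarrow> bool" where
  "det_matroid_base K r m n \<Omega> \<longleftrightarrow>
     det_matroid_indep K r m n \<Omega> \<and>
     (\<forall>\<Omega>'. det_matroid_indep K r m n \<Omega>' \<and> \<Omega> \<subseteq> \<Omega>' \<longrightarrow> \<Omega>' = \<Omega>)"

definition col_support :: "(nat \<Rightarrow> nat set) \<Rightarrow> nat set \<Rightarrow> (nat \<times> nat) set" where
  "col_support \<omega> J = (\<Union>j\<in>J. \<omega> j \<times> {j})"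

text \<open>\<open>relaxed_SLMF \<nu> r m \<omega> J\<close>: the set \<open>col_support \<omega> J\<close> is a relaxed \<open>(\<nu>,r,m)\<close>-SLMF.\<close>

definition relaxed_SLMF ::
  "nat \<Rightarrow> nat \<Rightarrow> nat \<Rightarrow> (nat \<Rightarrow> nat set) \<Rightarrow> nat set \<Rightarrow> bool" where
  "relaxed_SLMF \<nu> r m \<omega> J \<longleftrightarrow>
     (\<forall>I. I \<subseteq> {..<m} \<and> card I \<ge> r + 1 \<longrightarrow>
        (\<Sum>j\<in>J. max (int (card (\<omega> j \<inter> I)) - int r) 0) \<le> int \<nu> * (int (card I) - int r)) \<and>
     (\<Sum>j\<in>J. max (int (card (\<omega> j \<inter> {..<m})) - int r) 0) = int \<nu> * (int m - int r)"

end

theory Submission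
  imports Defs "HOL-Computational_Algebra.Polynomial"
begin

text \<open>
  The circle of implications is (a) \<open>\<Longrightarrow>\<close> independent \<open>\<Longrightarrow>\<close> (b) \<open>\<Longrightarrow>\<close> (a); neither the primeness of the
  determinantal ideal nor any transcendence degree is needed.

  If (a) holds, take the matrix of rank \<open>r\<close> with entries \<open>t\<^sub>i ^ l\<close> in the columns of the \<open>l\<close>-th part,
  for distinct scalars \<open>t\<^sub>i\<close>. A leaf-removal argument on the rows shows that every vector on \<open>\<Omega>\<close>
  is the projection of a tangent vector there. A polynomial in the ideal vanishes on the
  corresponding curves of matrices of rank at most \<open>r\<close>; comparing terms of lowest order in the
  curve parameter, it vanishes everywhere, and hence is zero because the field is infinite.

  Conversely, modulo the minors of size \<open>r + 1\<close> every monomial is a combination of monomials whose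
  support contains no strictly increasing chain of length \<open>r + 1\<close>. Such a support inside \<open>S \<times> T\<close>
  has at most \<open>r (#S + #T - r)\<close> elements, so counting monomials of bounded degree bounds the part
  of an independent set inside \<open>S \<times> T\<close> by the same number. Applied to a set of rows \<open>I\<close> and the
  columns with more than \<open>r\<close> entries in \<open>I\<close>, this is the inequality of (b).

  From (b) the partition is explicit: full columns form a part alone, and if \<open>m = r + 2\<close> the columns
  lacking one entry, sorted by the missing row, are matched at distance half their number.
\<close>

section \<open>Evaluation of polynomials\<close>

definition mono_val :: "('v \<Rightarrow> 'a::comm_semiring_1) \<Rightarrow> ('v \<Rightarrow>\<^sub>0 nat) \<Rightarrow> 'a" where
  "mono_val x t = (\<Prod>v\<in>Poly_Mapping.keys t. x v ^ Poly_Mapping.lookup t v)"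

lemma mono_val_superset:
  assumes "finite V" "Poly_Mapping.keys t \<subseteq> V"
  shows "mono_val x t = (\<Prod>v\<in>V. x v ^ Poly_Mapping.lookup t v)"
  unfolding mono_val_def using assms
  by (intro prod.mono_neutral_left) (auto simp: in_keys_iff)

lemma mono_val_add: "mono_val x (s + t) = mono_val x s * mono_val x t"
proof -
  let ?V = "Poly_Mapping.keys s \<union> Poly_Mapping.keys t"
  have "mono_val x (s + t) = (\<Prod>v\<in>?V. x v ^ Poly_Mapping.lookup (s + t) v)"
    using Poly_Mapping.keys_add[of s t] by (intro mono_val_superset) auto
  also have "\<dots> = (\<Prod>v\<in>?V. x v ^ Poly_Mapping.lookup s v) * (\<Prod>v\<in>?V. x v ^ Poly_Mapping.lookup t v)"
    by (simp add: lookup_add power_add prod.distrib)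
  also have "\<dots> = mono_val x s * mono_val x t"
    by (simp add: mono_val_superset[of ?V])
  finally show ?thesis .
qed

text \<open>The target ring is general because values are taken in k, in k[s] along a line, and in
  k[\<epsilon>][s] along a family of lines; \<open>\<phi>\<close> embeds the constants.\<close>

definition peval :: "('k::field \<Rightarrow> 'a::comm_ring_1) \<Rightarrow> ('v \<Rightarrow> 'a) \<Rightarrow> ('v, 'k) mpoly \<Rightarrow> 'a" where
  "peval \<phi> x p = (\<Sum>t\<in>Poly_Mapping.keys p. \<phi> (Poly_Mapping.lookup p t) * mono_val x t)"

abbreviation point_val :: "('v \<Rightarrow> 'k::field) \<Rightarrow> ('v, 'k) mpoly \<Rightarrow> 'k" where
  "point_val \<equiv> peval (\<lambda>c. c)"

lemma point_val_superset:
  assumes "finite T" "Poly_Mapping.keys p \<subseteq> T"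
  shows "point_val x p = (\<Sum>t\<in>T. Poly_Mapping.lookup p t * mono_val x t)"
  unfolding peval_def using assms
  by (intro sum.mono_neutral_left) (auto simp: in_keys_iff)

lemma point_val_zero [simp]: "point_val x 0 = 0"
  by (simp add: peval_def)

lemma point_val_single [simp]: "point_val x (Poly_Mapping.single t c) = c * mono_val x t"
  by (cases "c = 0") (simp_all add: peval_def)

lemma point_val_one [simp]: "point_val x 1 = 1"
  using point_val_single[of x 0 1] by (simp add: mono_val_def)

lemma point_val_var [simp]: "point_val x (mpoly_var v) = x v"
  by (simp add: mpoly_var_def mono_val_def)

lemma point_val_add [simp]: "point_val x (p + q) = point_val x p + point_val x q"
proof -
  let ?T = "Poly_Mapping.keys p \<union> Poly_Mapping.keys q"
  have "point_val x (p + q) = (\<Sum>t\<in>?T. Poly_Mapping.lookup (p + q) t * mono_val x t)"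
    using Poly_Mapping.keys_add[of p q] by (intro point_val_superset) auto
  then show ?thesis
    by (simp add: point_val_superset[of ?T] lookup_add distrib_right sum.distrib)
qed

lemma point_val_uminus [simp]: "point_val x (- p) = - point_val x p"
  using point_val_add[of x p "- p"] by (simp add: eq_neg_iff_add_eq_0 add.commute del: point_val_add)

lemma point_val_sum: "point_val x (sum f A) = (\<Sum>a\<in>A. point_val x (f a))"
  by (induction A rule: infinite_finite_induct) auto

lemma mpoly_sum_monomials:
  "p = (\<Sum>t\<in>Poly_Mapping.keys p. Poly_Mapping.single t (Poly_Mapping.lookup p t))"
  by (rule poly_mapping_eqI)
    (simp add: lookup_sum lookup_single when_def in_keys_iff)

lemma point_val_mult [simp]: "point_val x (p * q) = point_val x p * point_val x q"
proof -
  have "p * q = (\<Sum>s\<in>Poly_Mapping.keys p. \<Sum>t\<in>Poly_Mapping.keys q.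
      Poly_Mapping.single (s + t) (Poly_Mapping.lookup p s * Poly_Mapping.lookup q t))"
    by (subst mpoly_sum_monomials[of p], subst mpoly_sum_monomials[of q])
      (simp add: sum_product mult_single)
  then show ?thesis
    by (simp add: point_val_sum mono_val_add peval_def[of _ _ p] peval_def[of _ _ q]
        sum_product algebra_simps)
qed

lemma point_val_prod: "point_val x (prod f A) = (\<Prod>a\<in>A. point_val x (f a))"
  by (induction A rule: infinite_finite_induct) auto

lemma point_val_signof [simp]: "point_val x (signof \<pi>) = signof \<pi>"
  by (simp add: sign_def)

section \<open>Polynomial functions over an infinite field\<close>

lemma poly_vanishing_zero:
  fixes g :: "'k::field poly"
  assumes "infinite (UNIV :: 'k set)" "\<And>s. poly g s = 0"
  shows "g = 0"
  using assms poly_roots_finite[of g] by auto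

text \<open>Induction on \<open>V\<close>: with the other variables frozen, the relation is a
  univariate polynomial in the value of \<open>w\<close> that vanishes everywhere. Its coefficient
  at the exponent of \<open>t\<close> is the relation for the monomials sharing that exponent.
  Exponents outside the current \<open>V\<close> are not compared, hence the injectivity of
  restrictions.\<close>

lemma monomials_independent:
  fixes c :: "('v \<Rightarrow>\<^sub>0 nat) \<Rightarrow> 'k::field"
  assumes inf: "infinite (UNIV :: 'k set)" and "finite V"
    and "finite T" "inj_on (\<lambda>t. restrict (Poly_Mapping.lookup t) V) T"
    and "\<And>x. (\<Sum>t\<in>T. c t * (\<Prod>v\<in>V. x v ^ Poly_Mapping.lookup t v)) = 0"
    and "t \<in> T"
  shows "c t = 0"
  using assms(2-)
proof (induction V arbitrary: T t rule: finite_induct)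
  case empty
  \<comment> \<open>All restrictions to the empty set coincide, so injectivity leaves a single
    monomial.\<close>
  then have "T = {t}" by (auto simp: inj_on_def)
  with empty.prems(3) show ?case by simp
next
  case (insert w V)
  define N where "N = (\<lambda>t::'v \<Rightarrow>\<^sub>0 nat. Poly_Mapping.lookup t w)"
  define T' where "T' = {s\<in>T. N s = N t}"
  show ?case
  proof (rule insert.IH)
    show "finite T'" "t \<in> T'" using insert.prems by (auto simp: T'_def)
    show "inj_on (\<lambda>t. restrict (Poly_Mapping.lookup t) V) T'"
    proof (rule inj_onI)
      fix s s' assume s: "s \<in> T'" "s' \<in> T'"
        and eq: "restrict (Poly_Mapping.lookup s) V = restrict (Poly_Mapping.lookup s') V"
      have "restrict (Poly_Mapping.lookup s) (insert w V) = restrict (Poly_Mapping.lookup s') (insert w V)"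
      proof
        fix v show "restrict (Poly_Mapping.lookup s) (insert w V) v = restrict (Poly_Mapping.lookup s') (insert w V) v"
          using fun_cong[OF eq, of v] s by (cases "v = w") (auto simp: T'_def N_def restrict_def split: if_splits)
      qed
      with insert.prems(2) s show "s = s'" unfolding T'_def by (blast dest: inj_onD)
    qed
    fix x :: "'v \<Rightarrow> 'k"
    define M where "M = (\<lambda>s. c s * (\<Prod>v\<in>V. x v ^ Poly_Mapping.lookup s v))"
    define P where "P = (\<Sum>s\<in>T. monom (M s) (N s))"
    have "poly P y = 0" for y
    proof -
      have "(\<Sum>s\<in>T. c s * (\<Prod>v\<in>insert w V. (x(w := y)) v ^ Poly_Mapping.lookup s v)) = 0"
        by (rule insert.prems)
      moreover have "(\<Prod>v\<in>V. (x(w := y)) v ^ Poly_Mapping.lookup s v) = (\<Prod>v\<in>V. x v ^ Poly_Mapping.lookup s v)" for s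
        using insert.hyps by (intro prod.cong) auto
      ultimately show ?thesis
        using insert.hyps by (simp add: P_def poly_sum poly_monom M_def N_def mult_ac)
    qed
    then have "P = 0"
      by (rule poly_vanishing_zero[OF inf])
    then have "0 = coeff P (N t)" by simp
    also have "\<dots> = (\<Sum>s\<in>T. if N s = N t then M s else 0)"
      by (simp add: P_def coeff_sum if_distrib cong: if_cong)
    also have "\<dots> = (\<Sum>s\<in>T'. M s)"
      unfolding T'_def using insert.prems(1) by (simp add: sum.inter_filter)
    finally show "(\<Sum>s\<in>T'. c s * (\<Prod>v\<in>V. x v ^ Poly_Mapping.lookup s v)) = 0"
      by (simp add: M_def)
  qed
qed

text \<open>The variables occurring in \<open>p\<close> form a finite set outside of which all its
  exponents vanish, so restriction to that set distinguishes its monomials.\<close>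

lemma point_val_identity:
  fixes p :: "('v, 'k::field) mpoly"
  assumes inf: "infinite (UNIV :: 'k set)" and zero: "\<And>x. point_val x p = 0"
  shows "p = 0"
proof -
  define V where "V = (\<Union>t\<in>Poly_Mapping.keys p. Poly_Mapping.keys t)"
  have "finite V" by (simp add: V_def)
  have "Poly_Mapping.lookup p t = 0" if "t \<in> Poly_Mapping.keys p" for t
  proof (rule monomials_independent[OF inf \<open>finite V\<close> _ _ _ that])
    show "inj_on (\<lambda>t. restrict (Poly_Mapping.lookup t) V) (Poly_Mapping.keys p)"
    proof (rule inj_onI)
      fix s s' assume s: "s \<in> Poly_Mapping.keys p" "s' \<in> Poly_Mapping.keys p"
        and eq: "restrict (Poly_Mapping.lookup s) V = restrict (Poly_Mapping.lookup s') V"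
      show "s = s'"
      proof (rule poly_mapping_eqI)
        fix v show "Poly_Mapping.lookup s v = Poly_Mapping.lookup s' v"
        proof (cases "v \<in> V")
          case True then show ?thesis using fun_cong[OF eq, of v] by simp
        next
          case False
          then show ?thesis using s unfolding V_def
            by (metis UN_I in_keys_iff)
        qed
      qed
    qed
    fix x :: "'v \<Rightarrow> 'k"
    have "mono_val x t = (\<Prod>v\<in>V. x v ^ Poly_Mapping.lookup t v)" if "t \<in> Poly_Mapping.keys p" for t
      using that by (intro mono_val_superset \<open>finite V\<close>) (auto simp: V_def)
    with zero[of x] show "(\<Sum>t\<in>Poly_Mapping.keys p. Poly_Mapping.lookup p t *
        (\<Prod>v\<in>V. x v ^ Poly_Mapping.lookup t v)) = 0"
      by (simp add: peval_def)
  qed simp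
  then show ?thesis
    by (metis in_keys_iff poly_mapping_eqI lookup_zero)
qed

section \<open>Expansion along lines and curves\<close>

text \<open>Specialising the inner variable in all coefficients respects constants, sums and
  products, hence evaluation of \<open>p\<close>; \<open>R F f\<close> says that \<open>f\<close> is
  the specialisation of \<open>F\<close>.\<close>

lemma coeff_eval_peval:
  fixes F :: "'k::field poly poly" and f :: "'k poly"
  fixes a :: "'v \<Rightarrow> 'k poly poly" and b :: "'v \<Rightarrow> 'k poly"
  assumes "\<And>v d. poly (coeff (a v) d) \<epsilon> = coeff (b v) d"
  shows "poly (coeff (peval (\<lambda>c. [:[:c:]:]) a p) d) \<epsilon> = coeff (peval (\<lambda>c. [:c:]) b p) d"
proof -
  define R where "R = (\<lambda>(F::'k poly poly) f. \<forall>d. poly (coeff F d) \<epsilon> = coeff f d)"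
  have one: "R 1 1"
    by (auto simp: R_def coeff_1 split: if_splits)
  have const: "R [:[:c:]:] [:c:]" for c
    by (auto simp: R_def coeff_pCons split: nat.splits)
  have mult: "R (F * G) (f * g)" if "R F f" "R G g" for F G f g
    using that by (auto simp: R_def coeff_mult poly_sum)
  have pow: "R (F ^ n) (f ^ n)" if "R F f" for F f n
    by (induction n) (auto intro: one mult that)
  have prod: "R (prod F A) (prod f A)" if "\<And>x. R (F x) (f x)" for F f and A :: "'v set"
    by (induction A rule: infinite_finite_induct) (auto intro: one mult that)
  have sum: "R (sum F A) (sum f A)" if "\<And>x. R (F x) (f x)" for F f and A :: "('v \<Rightarrow>\<^sub>0 nat) set"
    using that by (auto simp: R_def coeff_sum poly_sum)
  have "R (peval (\<lambda>c. [:[:c:]:]) a p) (peval (\<lambda>c. [:c:]) b p)"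
    unfolding peval_def mono_val_def
    by (intro sum mult const prod pow) (use assms in \<open>simp add: R_def\<close>)
  then show ?thesis by (simp add: R_def)
qed

lemma poly_peval: "poly (peval (\<lambda>c. [:c:]) b p) s = point_val (\<lambda>v. poly (b v) s) p"
  by (simp add: peval_def mono_val_def poly_sum poly_prod)

text \<open>The coefficient of \<open>s ^ d\<close> in \<open>p (M + s Y)\<close> is shown to vanish for all \<open>Y\<close>, by induction on \<open>d\<close>:
  once the lower coefficients vanish identically, \<open>Q\<close> only contributes to orders above \<open>d\<close>.\<close>

lemma vanishing_along_curves:
  fixes p :: "('v, 'k::field) mpoly" and M :: "'v \<Rightarrow> 'k"
  assumes inf: "infinite (UNIV :: 'k set)"
    and curve: "\<And>X. \<exists>Q. \<forall>\<epsilon>. point_val (\<lambda>v. M v + \<epsilon> * X v + \<epsilon>\<^sup>2 * Q v) p = 0"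
  shows "point_val y p = 0"
proof -
  \<comment> \<open>\<open>f Y\<close> is p(M + s Y) as a polynomial in s.\<close>
  define f where "f = (\<lambda>Y. peval (\<lambda>c. [:c:]) (\<lambda>v. [:M v, Y v:]) p)"
  note poly_zero = poly_vanishing_zero[OF inf]
  have "\<forall>Y. coeff (f Y) d = 0" for d
  proof (induction d rule: less_induct)
    case (less d)
    show ?case
    proof
      fix X
      obtain Q where Q: "\<forall>\<epsilon>. point_val (\<lambda>v. M v + \<epsilon> * X v + \<epsilon>\<^sup>2 * Q v) p = 0"
        using curve[of X] ..
      \<comment> \<open>This is \<open>p\<close> on the line through \<open>M\<close> in direction X
        + \<epsilon> Q, with outer variable s and inner variable \<epsilon>.\<close>
      define \<Phi> where "\<Phi> = peval (\<lambda>c. [:[:c:]:]) (\<lambda>v. [:[:M v:], [:X v, Q v:]:]) p"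
      have \<Phi>: "poly (coeff \<Phi> e) \<epsilon> = coeff (f (\<lambda>v. X v + \<epsilon> * Q v)) e" for e \<epsilon>
        unfolding \<Phi>_def f_def
        by (rule coeff_eval_peval) (auto simp: coeff_pCons split: nat.splits)
      have low: "coeff \<Phi> e = 0" if "e < d" for e
        using less[OF that] by (intro poly_zero) (simp add: \<Phi>)
      \<comment> \<open>Beyond the degree in s, and beyond \<open>d\<close> so that the index
        \<open>d\<close> occurs in the sum.\<close>
      define N where "N = Suc (max d (degree \<Phi>))"
      \<comment> \<open>Putting s = \<epsilon> turns the line into the curve of the hypothesis, on
        which \<open>p\<close> vanishes for every \<epsilon>.\<close>
      have "(\<Sum>e<N. coeff \<Phi> e * [:0, 1:] ^ e) = 0"
      proof (rule poly_zero)
        fix \<epsilon>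
        let ?f = "f (\<lambda>v. X v + \<epsilon> * Q v)"
        have "coeff ?f e = 0" if "e \<ge> N" for e
          using \<Phi>[of e \<epsilon>] that by (simp add: N_def coeff_eq_0)
        then have deg: "\<And>e. coeff ?f e \<noteq> 0 \<Longrightarrow> e < N" by (meson not_le)
        have "(\<Sum>e<N. coeff ?f e * \<epsilon> ^ e) = poly ?f \<epsilon>"
          unfolding poly_altdef
          by (rule sum.mono_neutral_cong) (use deg in \<open>auto simp: coeff_eq_0 not_le\<close>)
        also have "\<dots> = point_val (\<lambda>v. M v + \<epsilon> * X v + \<epsilon>\<^sup>2 * Q v) p"
          unfolding f_def poly_peval by (simp add: algebra_simps power2_eq_square)
        also have "\<dots> = 0" using Q ..
        finally show "poly (\<Sum>e<N. coeff \<Phi> e * [:0, 1:] ^ e) \<epsilon> = 0"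
          by (simp add: poly_sum \<Phi>)
      qed
      moreover have "(\<Sum>e<N. coeff \<Phi> e * [:0, 1:] ^ e) =
          (\<Sum>e\<in>{d..<N}. coeff \<Phi> e * [:0, 1:] ^ e)"
        by (rule sum.mono_neutral_right) (auto simp: low)
      moreover have "\<dots> = [:0, 1:] ^ d * (\<Sum>e\<in>{d..<N}. coeff \<Phi> e * [:0, 1:] ^ (e - d))"
        by (simp add: sum_distrib_left mult_ac flip: power_add)
      ultimately have "(\<Sum>e\<in>{d..<N}. coeff \<Phi> e * [:0, 1:] ^ (e - d)) = 0"
        by simp
      \<comment> \<open>With the factor \<epsilon>^d cancelled, \<epsilon> = 0 isolates the term of
        index \<open>d\<close>, and there the direction is \<open>X\<close> itself.\<close>
      then have "0 = poly (\<Sum>e\<in>{d..<N}. coeff \<Phi> e * [:0, 1:] ^ (e - d)) 0" by simp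
      also have "\<dots> = (\<Sum>e\<in>{d..<N}. if e = d then poly (coeff \<Phi> e) 0 else 0)"
        by (simp only: poly_sum) (intro sum.cong, auto simp: power_0_left)
      also have "\<dots> = poly (coeff \<Phi> d) 0" by (simp add: N_def)
      finally show "coeff (f X) d = 0" by (simp add: \<Phi>)
    qed
  qed
  then have "f Y = 0" for Y by (simp add: poly_eq_iff)
  then have "poly (f (\<lambda>v. y v - M v)) 1 = 0" by simp
  then show ?thesis unfolding f_def poly_peval by simp
qed

section \<open>The determinantal ideal\<close>

lemma generic_minor:
  assumes "I \<subseteq> {..<m}" "J \<subseteq> {..<n}" "card I = s" "card J = s"
  shows "det (submatrix (generic_mat m n) I J :: (nat \<times> nat, 'k::field) mpoly mat) =
    (\<Sum>\<sigma> | \<sigma> permutes {0..<s}. signof \<sigma> * (\<Prod>a = 0..<s. mpoly_var (pick I a, pick J (\<sigma> a))))"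
proof -
  let ?S = "submatrix (generic_mat m n) I J :: (nat \<times> nat, 'k) mpoly mat"
  have eqs: "{i. i < m \<and> i \<in> I} = I" "{j. j < n \<and> j \<in> J} = J"
    using assms by auto
  have S: "?S = mat s s (\<lambda>(a, b). generic_mat m n $$ (pick I a, pick J b))"
    by (simp add: submatrix_def generic_mat_def eqs assms)
  have bound: "pick I a < m" "pick J a < n" if "a < s" for a
    using that assms by (auto dest!: subsetD intro: pick_in_set_le)
  have "?S \<in> carrier_mat s s" by (simp add: S)
  then have "det ?S = (\<Sum>\<sigma> | \<sigma> permutes {0..<s}. signof \<sigma> * (\<Prod>a = 0..<s. ?S $$ (a, \<sigma> a)))"
    by (rule det_def')
  also have "\<dots> = (\<Sum>\<sigma> | \<sigma> permutes {0..<s}. signof \<sigma> * (\<Prod>a = 0..<s. mpoly_var (pick I a, pick J (\<sigma> a))))"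
  proof (intro sum.cong refl arg_cong2[of _ _ _ _ "(*)"] prod.cong)
    fix \<sigma> a assume "\<sigma> \<in> {\<sigma>. \<sigma> permutes {0..<s}}" "a \<in> {0..<s}"
    then have "a < s" "\<sigma> a < s" using permutes_in_image[of \<sigma> "{0..<s}" a] by auto
    then show "?S $$ (a, \<sigma> a) = mpoly_var (pick I a, pick J (\<sigma> a))"
      unfolding S using bound by (simp add: generic_mat_def)
  qed
  finally show ?thesis .
qed

section \<open>Matrices of rank at most \<open>r\<close>\<close>

text \<open>Padding with zeros writes the matrix as a product of two square matrices of size
  \<open>s\<close>; row \<open>r\<close> of the second one is zero.\<close>

lemma det_low_rank:
  fixes U W :: "nat \<Rightarrow> nat \<Rightarrow> 'k::field"
  assumes "r < s"
  shows "det (mat s s (\<lambda>(a, b). \<Sum>l<r. U a l * W l b)) = 0"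
proof -
  define A where "A = mat s s (\<lambda>(a, l). if l < r then U a l else 0)"
  define B where "B = mat s s (\<lambda>(l, b). if l < r then W l b else 0)"
  have dims: "A \<in> carrier_mat s s" "B \<in> carrier_mat s s" by (simp_all add: A_def B_def)
  have "mat s s (\<lambda>(a, b). \<Sum>l<r. U a l * W l b) = A * B"
  proof (rule eq_matI)
    fix a b assume "a < dim_row (A * B)" "b < dim_col (A * B)"
    then have ab: "a < s" "b < s" using dims by auto
    have "(\<Sum>l<r. U a l * W l b) = (\<Sum>l = 0..<s. (if l < r then U a l else 0) * (if l < r then W l b else 0))"
      using assms by (intro sum.mono_neutral_cong_left) auto
    then show "mat s s (\<lambda>(a, b). \<Sum>l<r. U a l * W l b) $$ (a, b) = (A * B) $$ (a, b)"
      using ab by (simp add: A_def B_def scalar_prod_def)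
  qed (use dims in auto)
  moreover have "det B = 0"
  proof -
    have "(\<Prod>i = 0..<s. B $$ (i, \<sigma> i)) = 0" if "\<sigma> permutes {0..<s}" for \<sigma>
    proof (rule prod_zero)
      have "\<sigma> r < s" using permutes_in_image[OF that, of r] assms by auto
      then have "B $$ (r, \<sigma> r) = 0" using assms by (simp add: B_def)
      then show "\<exists>i\<in>{0..<s}. B $$ (i, \<sigma> i) = 0" using assms by auto
    qed simp
    then show ?thesis unfolding det_def'[OF dims(2)]
      by (intro sum.neutral ballI) (simp only: mem_Collect_eq mult_zero_right)
  qed
  ultimately show ?thesis by (simp add: det_mult[OF dims])
qed

text \<open>Lets vanishing at given points pass from generators to the generated ideal, by
  minimality of the latter.\<close>

lemma ideal_vanishing:
  "ideal {p \<in> carrier (mpoly_ring V). \<forall>x\<in>X. point_val x p = 0} (mpoly_ring V :: ('v, 'k::field) mpoly ring)"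
    (is "ideal ?K ?R")
proof (rule idealI)
  interpret R: cring ?R by (rule cring_mpoly_ring)
  show "ring ?R" by (rule R.ring_axioms)
  show "subgroup ?K (add_monoid ?R)"
  proof (rule R.add.subgroupI)
    show "?K \<noteq> {}" using R.zero_closed by (auto intro!: exI[of _ 0])
    fix p assume p: "p \<in> ?K"
    then have mem: "- p \<in> carrier ?R" by (simp add: mpoly_ring_carrier_iff)
    have "\<ominus>\<^bsub>?R\<^esub> p = - p" by (rule R.minus_equality) (use p mem in auto)
    with p mem show "\<ominus>\<^bsub>?R\<^esub> p \<in> ?K" by simp
  qed (auto intro: mpoly_ring_add_closed)
qed (auto intro: mpoly_ring_mult_closed)

abbreviation grid :: "nat \<Rightarrow> nat \<Rightarrow> (nat \<times> nat) set" where
  "grid m n \<equiv> {..<m} \<times> {..<n}"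

lemma ideal_det_ideal:
  "ideal (det_ideal r m n :: (nat \<times> nat, 'k::field) mpoly set) (mpoly_ring (grid m n))"
proof -
  interpret R: cring "mpoly_ring (grid m n) :: (nat \<times> nat, 'k) mpoly ring" by (rule cring_mpoly_ring)
  show ?thesis
    unfolding det_ideal_def det_poly_ring_def
    by (rule R.genideal_ideal) (rule minors_generic_mat_subset[unfolded det_poly_ring_def])
qed

lemma det_ideal_vanishes:
  fixes U W :: "nat \<Rightarrow> nat \<Rightarrow> 'k::field"
  assumes "p \<in> det_ideal r m n"
  shows "point_val (\<lambda>(i, j). \<Sum>l<r. U i l * W l j) p = 0"
proof -
  let ?R = "mpoly_ring (grid m n) :: (nat \<times> nat, 'k) mpoly ring"
  let ?x = "\<lambda>(i, j). \<Sum>l<r. U i l * W l j"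
  interpret R: cring ?R by (rule cring_mpoly_ring)
  have "det_ideal r m n \<subseteq> {p \<in> carrier ?R. \<forall>x\<in>{?x}. point_val x p = 0}"
    unfolding det_ideal_def det_poly_ring_def
  proof (rule R.genideal_minimal[OF ideal_vanishing], intro subsetI CollectI conjI ballI)
    fix d :: "(nat \<times> nat, 'k) mpoly" and x
    assume d: "d \<in> minors (r + 1) (generic_mat m n)" and "x \<in> {?x}"
    then have x: "x = ?x" by simp
    from d obtain I J where IJ: "d = det (submatrix (generic_mat m n) I J)"
      "I \<subseteq> {..<m}" "J \<subseteq> {..<n}" "card I = r + 1" "card J = r + 1"
      unfolding minors_def by (auto simp: generic_mat_def)
    let ?A = "mat (r + 1) (r + 1) (\<lambda>(a, b). \<Sum>l<r. U (pick I a) l * W l (pick J b))"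
    have "point_val x d = (\<Sum>\<sigma> | \<sigma> permutes {0..<r + 1}. signof \<sigma> *
        (\<Prod>a = 0..<r + 1. \<Sum>l<r. U (pick I a) l * W l (pick J (\<sigma> a))))"
      unfolding IJ(1) generic_minor[OF IJ(2-5)] x
      by (simp only: point_val_sum point_val_mult point_val_prod point_val_signof point_val_var split_conv)
    also have "\<dots> = (\<Sum>\<sigma> | \<sigma> permutes {0..<r + 1}. signof \<sigma> * (\<Prod>a = 0..<r + 1. ?A $$ (a, \<sigma> a)))"
    proof (intro sum.cong refl arg_cong2[of _ _ _ _ "(*)"] prod.cong)
      fix \<sigma> a assume "\<sigma> \<in> {\<sigma>. \<sigma> permutes {0..<r + 1}}" "a \<in> {0..<r + 1}"
      then have "a < r + 1" "\<sigma> a < r + 1" using permutes_in_image[of \<sigma> "{0..<r + 1}" a] by auto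
      then show "(\<Sum>l<r. U (pick I a) l * W l (pick J (\<sigma> a))) = ?A $$ (a, \<sigma> a)"
        by (simp only: index_mat split_conv)
    qed
    also have "\<dots> = det ?A" by (rule det_def'[symmetric]) simp
    also have "\<dots> = 0" by (rule det_low_rank) simp
    finally show "point_val x d = 0" .
  qed (use minors_generic_mat_subset in \<open>auto simp: det_poly_ring_def\<close>)
  with assms show ?thesis by auto
qed

section \<open>Independence as a condition on the ideal\<close>

lemma mpoly_ring_finsum:
  assumes "\<And>a. a \<in> A \<Longrightarrow> f a \<in> carrier (mpoly_ring V :: ('v, 'k::field) mpoly ring)"
  shows "finsum (mpoly_ring V) f A = sum f A"
proof -
  interpret R: cring "mpoly_ring V :: ('v, 'k) mpoly ring" by (rule cring_mpoly_ring)
  show ?thesis using assms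
    by (induction A rule: infinite_finite_induct) (auto simp: R.finsum_insert Pi_def)
qed

lemma mpoly_ring_finprod:
  assumes "\<And>a. a \<in> A \<Longrightarrow> f a \<in> carrier (mpoly_ring V :: ('v, 'k::field) mpoly ring)"
  shows "finprod (mpoly_ring V) f A = prod f A"
proof -
  interpret R: cring "mpoly_ring V :: ('v, 'k) mpoly ring" by (rule cring_mpoly_ring)
  show ?thesis using assms
    by (induction A rule: infinite_finite_induct) (auto simp: Pi_def)
qed

lemma mpoly_ring_nat_pow: "p [^]\<^bsub>mpoly_ring V\<^esub> (e::nat) = p ^ e"
  by (induction e) (simp_all add: mult.commute)

lemma single_prod:
  "(\<Prod>a\<in>A. Poly_Mapping.single (h a) 1) = (Poly_Mapping.single (\<Sum>a\<in>A. h a) 1 :: ('v, 'k::field) mpoly)"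
  by (induction A rule: infinite_finite_induct) (simp_all add: mult_single)

lemma mpoly_const_mult_monomial:
  "mpoly_const c * mono_val mpoly_var t = Poly_Mapping.single t (c::'k::field)"
proof -
  have pow: "mpoly_var v ^ e = (Poly_Mapping.single (Poly_Mapping.single v e) 1 :: ('v, 'k) mpoly)" for v :: 'v and e
    by (induction e) (simp_all add: mpoly_var_def mult_single single_add[symmetric])
  have "(\<Sum>v\<in>Poly_Mapping.keys t. Poly_Mapping.single v (Poly_Mapping.lookup t v)) = t"
    by (rule poly_mapping_eqI) (simp add: lookup_sum lookup_single when_def in_keys_iff)
  then show ?thesis
    by (simp add: mono_val_def pow single_prod mpoly_const_def mult_single)
qed

text \<open>A polynomial is a sum of constants times powers of variables, and \<open>h\<close>
  preserves sums and products. For the quotient map this identifies evaluation at the residues with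
  the residue of the polynomial.\<close>

lemma mpoly_eval_hom:
  assumes hom: "ring_hom_cring (mpoly_ring V) A h" and p: "p \<in> carrier (mpoly_ring V)"
  shows "mpoly_eval A (\<lambda>c. h (mpoly_const c)) (\<lambda>v. h (mpoly_var v)) p = h (p :: ('v, 'k::field) mpoly)"
proof -
  let ?R = "mpoly_ring V :: ('v, 'k) mpoly ring"
  interpret h: ring_hom_cring ?R A h by (rule hom)
  have const: "mpoly_const c \<in> carrier ?R" for c
    by (simp add: mpoly_const_def mpoly_ring_carrier_iff)
  have var: "mpoly_var v \<in> carrier ?R" if "v \<in> V" for v
    using that by (simp add: mpoly_var_def mpoly_ring_carrier_iff)
  have keys: "v \<in> V" if "t \<in> Poly_Mapping.keys p" "v \<in> Poly_Mapping.keys t" for t v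
    using p that by (auto simp: mpoly_ring_carrier_iff)
  have pow: "mpoly_var v ^ e \<in> carrier ?R" if "v \<in> V" for v e
    using h.R.nat_pow_closed[OF var[OF that], of e] by (simp add: mpoly_ring_nat_pow)
  have hpow: "h (mpoly_var v ^ e) = h (mpoly_var v) [^]\<^bsub>A\<^esub> e" if v: "v \<in> V" for v e
  proof (induction e)
    case (Suc e)
    then show ?case using h.hom_mult[OF pow[OF v, of e] var[OF v]] by (simp add: mult.commute)
  qed (use h.hom_one in simp)
  have "h (mpoly_const c * mono_val mpoly_var t) = h (mpoly_const c) \<otimes>\<^bsub>A\<^esub>
      (\<Otimes>\<^bsub>A\<^esub>v\<in>Poly_Mapping.keys t. h (mpoly_var v) [^]\<^bsub>A\<^esub> Poly_Mapping.lookup t v)"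
    and mono: "mpoly_const c * mono_val mpoly_var t \<in> carrier ?R"
    if t: "t \<in> Poly_Mapping.keys p" for c t
  proof -
    let ?f = "\<lambda>v. (mpoly_var v :: ('v, 'k) mpoly) ^ Poly_Mapping.lookup t v"
    have f: "?f \<in> Poly_Mapping.keys t \<rightarrow> carrier ?R" using pow keys[OF t] by auto
    have eq: "mono_val mpoly_var t = (\<Otimes>\<^bsub>?R\<^esub>v\<in>Poly_Mapping.keys t. ?f v)"
      unfolding mono_val_def using f by (subst mpoly_ring_finprod) auto
    have mem: "mono_val mpoly_var t \<in> carrier ?R" unfolding eq by (rule h.R.finprod_closed[OF f])
    show "mpoly_const c * mono_val mpoly_var t \<in> carrier ?R"
      using mpoly_ring_mult_closed[OF const mem] .
    have "h (mpoly_const c * mono_val mpoly_var t) = h (mpoly_const c) \<otimes>\<^bsub>A\<^esub> h (mono_val mpoly_var t)"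
      using h.hom_mult[OF const mem] by simp
    also have "h (mono_val mpoly_var t) = (\<Otimes>\<^bsub>A\<^esub>v\<in>Poly_Mapping.keys t. h (?f v))"
      unfolding eq by (subst h.hom_finprod[OF f]) (simp add: comp_def)
    also have "\<dots> = (\<Otimes>\<^bsub>A\<^esub>v\<in>Poly_Mapping.keys t. h (mpoly_var v) [^]\<^bsub>A\<^esub> Poly_Mapping.lookup t v)"
    proof (rule h.S.finprod_cong')
      fix v assume "v \<in> Poly_Mapping.keys t"
      then show "h (?f v) = h (mpoly_var v) [^]\<^bsub>A\<^esub> Poly_Mapping.lookup t v"
        using hpow keys[OF t] by simp
    qed (use var keys[OF t] in auto)
    finally show "h (mpoly_const c * mono_val mpoly_var t) = h (mpoly_const c) \<otimes>\<^bsub>A\<^esub>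
      (\<Otimes>\<^bsub>A\<^esub>v\<in>Poly_Mapping.keys t. h (mpoly_var v) [^]\<^bsub>A\<^esub> Poly_Mapping.lookup t v)" .
  qed
  note hmono = this(1)
  let ?g = "\<lambda>t. mpoly_const (Poly_Mapping.lookup p t) * mono_val mpoly_var t"
  have g: "?g \<in> Poly_Mapping.keys p \<rightarrow> carrier ?R" using mono by auto
  have "p = (\<Oplus>\<^bsub>?R\<^esub>t\<in>Poly_Mapping.keys p. ?g t)"
    using mono by (subst mpoly_ring_finsum) (auto simp: mpoly_const_mult_monomial mpoly_sum_monomials[symmetric])
  then have "h p = (\<Oplus>\<^bsub>A\<^esub>t\<in>Poly_Mapping.keys p. h (?g t))"
    using h.hom_finsum[OF g] by (simp add: comp_def)
  also have "\<dots> = mpoly_eval A (\<lambda>c. h (mpoly_const c)) (\<lambda>v. h (mpoly_var v)) p"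
    unfolding mpoly_eval_def
    by (rule h.S.finsum_cong') (use hmono mono h.hom_closed in \<open>auto simp flip: hmono\<close>)
  finally show ?thesis by simp
qed

text \<open>Evaluation at the residues of the variables is the quotient map, so the relations among
  them are the polynomials in the variables of \<open>\<Omega>\<close> that lie in the ideal. All
  later arguments work with the ideal.\<close>

lemma det_matroid_indep_iff:
  "det_matroid_indep TYPE('k::field) r m n \<Omega> \<longleftrightarrow>
     \<Omega> \<subseteq> grid m n \<and> (\<forall>p :: (nat \<times> nat, 'k) mpoly.
       p \<in> carrier (mpoly_ring \<Omega>) \<and> p \<in> det_ideal r m n \<longrightarrow> p = 0)"
proof (cases "\<Omega> \<subseteq> grid m n")
  case True
  let ?R = "mpoly_ring (grid m n) :: (nat \<times> nat, 'k) mpoly ring"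
  let ?I = "det_ideal r m n :: (nat \<times> nat, 'k) mpoly set"
  let ?h = "\<lambda>p. ?I +>\<^bsub>?R\<^esub> p"
  interpret I: ideal ?I ?R by (rule ideal_det_ideal)
  have hom: "ring_hom_cring ?R (?R Quot ?I) ?h"
    by (rule I.rcos_ring_hom_cring) (rule cring_mpoly_ring)
  have "mpoly_eval (?R Quot ?I) (\<lambda>c. ?h (mpoly_const c)) (\<lambda>v. ?h (mpoly_var v)) p = \<zero>\<^bsub>?R Quot ?I\<^esub> \<longleftrightarrow> p \<in> ?I"
    if "p \<in> carrier (mpoly_ring \<Omega>)" for p
  proof -
    have p: "p \<in> carrier ?R" using that True by (auto simp: mpoly_ring_carrier_iff)
    have "?h p = ?I \<longleftrightarrow> p \<in> ?I"
      using I.a_rcos_const I.a_rcos_self[OF p] by auto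
    moreover have "\<zero>\<^bsub>?R Quot ?I\<^esub> = ?I" by (simp add: FactRing_def)
    ultimately show ?thesis unfolding mpoly_eval_hom[OF hom p] by simp
  qed
  then show ?thesis
    using True unfolding det_matroid_indep_def algebraically_independent_def
      det_coord_ring_def det_residue_def det_poly_ring_def by auto
qed (simp add: det_matroid_indep_def)

section \<open>Straightening and dimension count\<close>

text \<open>The positions \<open>(f a, g a)\<close> are those of the diagonal of a minor of size
  \<open>s\<close>.\<close>

definition has_chain :: "nat \<Rightarrow> (nat \<times> nat) set \<Rightarrow> bool" where
  "has_chain s D \<longleftrightarrow> (\<exists>f g. (\<forall>a b. a < b \<and> b < s \<longrightarrow> f a < f b \<and> g a < g b) \<and> (\<forall>a<s. (f a, g a) \<in> D))"

lemma card_less_strict_mono: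
  fixes i i' :: nat
  assumes "finite S" "i \<in> S" "i < i'"
  shows "card {x\<in>S. x < i} < card {x\<in>S. x < i'}"
  using assms by (intro psubset_card_mono) auto

text \<open>Induction on \<open>r\<close>: the minimal elements of \<open>D\<close> form an antichain, on which the difference of the
  ranks of row and column is injective; the other elements avoid the first row and column.\<close>

lemma chain_free_card:
  assumes "finite S" "finite T" "D \<subseteq> S \<times> T" "\<not> has_chain (r + 1) D" "r \<le> card S" "r \<le> card T"
  shows "card D + r * r \<le> r * (card S + card T)"
  using assms
proof (induction r arbitrary: S T D)
  case 0
  have "D = {}"
  proof (rule ccontr)
    assume "D \<noteq> {}"
    then obtain i j where "(i, j) \<in> D" by auto
    then have "has_chain 1 D" unfolding has_chain_def
      by (intro exI[of _ "\<lambda>_. i"] exI[of _ "\<lambda>_. j"]) auto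
    with 0 show False by simp
  qed
  then show ?case by simp
next
  case (Suc r)
  define L where "L = {(i, j). (i, j) \<in> D \<and> \<not> (\<exists>i' j'. (i', j') \<in> D \<and> i' < i \<and> j' < j)}"
  define D' where "D' = D - L"
  have ne: "S \<noteq> {}" "T \<noteq> {}" using Suc.prems by auto
  have finD: "finite D" using Suc.prems finite_subset by blast
  have smaller: "\<exists>i' j'. (i', j') \<in> D \<and> i' < i \<and> j' < j" if "(i, j) \<in> D'" for i j
    using that by (auto simp: D'_def L_def)
  have "D' \<subseteq> (S - {Min S}) \<times> (T - {Min T})"
  proof
    fix v assume "v \<in> D'"
    then obtain i j where ij: "v = (i, j)" "(i, j) \<in> D'" by (cases v) auto
    obtain i' j' where s: "(i', j') \<in> D" "i' < i" "j' < j" using smaller[OF ij(2)] by auto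
    have "i' \<in> S" "j' \<in> T" "i \<in> S" "j \<in> T" using s(1) ij(2) Suc.prems(3) by (auto simp: D'_def)
    moreover from this have "Min S \<le> i'" "Min T \<le> j'" using Suc.prems by auto
    ultimately show "v \<in> (S - {Min S}) \<times> (T - {Min T})" using s ij by auto
  qed
  moreover have "\<not> has_chain (r + 1) D'"
  proof
    assume "has_chain (r + 1) D'"
    then obtain f g where fg: "\<And>a b. a < b \<Longrightarrow> b < r + 1 \<Longrightarrow> f a < f b \<and> g a < g b"
      "\<And>a. a < r + 1 \<Longrightarrow> (f a, g a) \<in> D'" unfolding has_chain_def by blast
    \<comment> \<open>An element of \<open>D\<close> below the start of a chain in \<open>D'\<close>
      prolongs it by one.\<close>
    obtain i j where ij: "(i, j) \<in> D" "i < f 0" "j < g 0" using smaller[OF fg(2)[of 0]] by auto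
    have le: "f 0 \<le> f b \<and> g 0 \<le> g b" if "b < r + 1" for b
      using fg(1)[of 0 b] that by (cases "b = 0") auto
    have "has_chain (Suc r + 1) D"
      unfolding has_chain_def
    proof (intro exI conjI allI impI)
      let ?F = "\<lambda>a. case a of 0 \<Rightarrow> i | Suc a \<Rightarrow> f a" and ?G = "\<lambda>a. case a of 0 \<Rightarrow> j | Suc a \<Rightarrow> g a"
      fix a b assume "a < b \<and> b < Suc r + 1"
      then show "?F a < ?F b" "?G a < ?G b"
        using fg(1) le ij by (auto split: nat.split intro: less_le_trans)
    next
      fix a assume "a < Suc r + 1"
      then show "(case a of 0 \<Rightarrow> i | Suc a \<Rightarrow> f a, case a of 0 \<Rightarrow> j | Suc a \<Rightarrow> g a) \<in> D"
        using fg(2) ij by (auto split: nat.split simp: D'_def)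
    qed
    with Suc.prems show False by simp
  qed
  moreover have cardS: "card (S - {Min S}) = card S - 1" "card (T - {Min T}) = card T - 1"
    using Suc.prems ne by simp_all
  ultimately have IH: "card D' + r * r \<le> r * (card S - 1 + (card T - 1))"
    using Suc.IH[of "S - {Min S}" "T - {Min T}" D'] Suc.prems by simp
  \<comment> \<open>Equal differences of ranks force rows and columns to move in the same direction,
    which \<open>anti\<close> forbids. The differences range over \<open>card S + card T - 1\<close>
    integers.\<close>
  define h where "h = (\<lambda>(i, j). int (card {x\<in>S. x < i}) - int (card {x\<in>T. x < j}))"
  have "inj_on h L"
  proof (rule inj_onI)
    fix v w assume "v \<in> L" "w \<in> L" "h v = h w"
    then obtain i j i' j' where v: "v = (i, j)" "(i, j) \<in> L" "w = (i', j')" "(i', j') \<in> L"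
      and eq: "int (card {x\<in>S. x < i}) - int (card {x\<in>T. x < j}) =
        int (card {x\<in>S. x < i'}) - int (card {x\<in>T. x < j'})"
      by (cases v; cases w) (auto simp: h_def)
    have mem: "i \<in> S" "i' \<in> S" "j \<in> T" "j' \<in> T" using v Suc.prems(3) by (auto simp: L_def)
    have anti: "\<not> (i < i' \<and> j < j')" "\<not> (i' < i \<and> j' < j)" using v by (auto simp: L_def)
    note mono = card_less_strict_mono[OF Suc.prems(1)] card_less_strict_mono[OF Suc.prems(2)]
    show "v = w"
      using mono(1)[of i i'] mono(1)[of i' i] mono(2)[of j j'] mono(2)[of j' j] mem anti eq v
      by (cases i i' rule: linorder_cases; cases j j' rule: linorder_cases) auto
  qed
  moreover have "h ` L \<subseteq> {1 - int (card T)..int (card S) - 1}"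
  proof
    fix z assume "z \<in> h ` L"
    then obtain i j where ij: "z = h (i, j)" "i \<in> S" "j \<in> T" using Suc.prems(3) by (auto simp: L_def)
    have "card {x\<in>S. x < i} < card S" "card {x\<in>T. x < j} < card T"
      using ij Suc.prems by (auto intro!: psubset_card_mono)
    then show "z \<in> {1 - int (card T)..int (card S) - 1}" by (simp add: ij h_def)
  qed
  ultimately have "card L \<le> card {1 - int (card T)..int (card S) - 1}"
    by (intro card_inj_on_le) auto
  then have cardL: "card L \<le> card S + card T - 1" using Suc.prems by simp
  have "L \<subseteq> D" by (auto simp: L_def)
  then have cardD: "card D = card D' + card L"
    unfolding D'_def using finD card_mono[of D L] by (simp add: card_Diff_subset finite_subset)
  \<comment> \<open>Writing the sizes as successors removes the truncated subtractions.\<close>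
  obtain a b where ab: "card S = Suc a" "card T = Suc b"
    using Suc.prems by (cases "card S"; cases "card T") auto
  show ?case
    using cardL cardD IH unfolding ab by (simp add: algebra_simps)
qed

section \<open>Diagonal terms of minors\<close>

text \<open>The least moved point \<open>a\<close> is sent upwards and its preimage \<open>b\<close>
  lies after it, which is an inversion.\<close>

lemma permutation_inversion:
  fixes \<sigma> :: "nat \<Rightarrow> nat"
  assumes \<sigma>: "\<sigma> permutes {0..<s}" and "\<sigma> \<noteq> id"
  shows "\<exists>a b. a < b \<and> b < s \<and> \<sigma> b < \<sigma> a"
proof -
  define a where "a = (LEAST a. \<sigma> a \<noteq> a)"
  have "\<exists>a. \<sigma> a \<noteq> a" using assms(2) by (auto simp: fun_eq_iff)
  then have a: "\<sigma> a \<noteq> a" unfolding a_def by (rule LeastI_ex)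
  have below: "\<sigma> b = b" if "b < a" for b using not_less_Least[of b "\<lambda>a. \<sigma> a \<noteq> a"] that a_def by auto
  have inj: "\<And>x y. \<sigma> x = \<sigma> y \<Longrightarrow> x = y" using permutes_inj[OF \<sigma>] by (auto dest: injD)
  obtain b where b: "\<sigma> b = a" using permutes_surj[OF \<sigma>] by (metis surj_def)
  have "a < b" using below[of b] a b by (cases a b rule: linorder_cases) auto
  moreover have "a < \<sigma> a" using below[of "\<sigma> a"] a inj by (cases a "\<sigma> a" rule: linorder_cases) auto
  moreover have "b < s"
  proof (rule ccontr)
    assume "\<not> b < s"
    then have "\<sigma> b = b" using \<sigma> by (auto simp: permutes_def)
    with a b show False by simp
  qed
  ultimately show ?thesis using b by (intro exI[of _ a] exI[of _ b]) simp
qed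

text \<open>With weight \<open>i * j\<close> for the variable at \<open>(i, j)\<close>, the diagonal term of a minor is its unique
  term of largest weight, which makes straightening terminate.\<close>

lemma strict_rearrangement:
  fixes f g :: "nat \<Rightarrow> nat"
  assumes mono: "\<And>a b. a < b \<Longrightarrow> b < s \<Longrightarrow> f a < f b \<and> g a < g b"
    and \<sigma>: "\<sigma> permutes {0..<s}" "\<sigma> \<noteq> id"
  shows "(\<Sum>a = 0..<s. f a * g (\<sigma> a)) < (\<Sum>a = 0..<s. f a * g a)"
proof -
  define F where "F = (\<lambda>\<sigma>. \<Sum>a = 0..<s. f a * g (\<sigma> a))"
  let ?P = "{\<sigma>. \<sigma> permutes {0..<s}}"
  \<comment> \<open>Undoing an inversion strictly increases the sum, so only the identity can attain
    the maximum over all permutations.\<close>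
  have step: "\<exists>\<tau>\<in>?P. F \<sigma> < F \<tau>" if \<sigma>: "\<sigma> \<in> ?P" "\<sigma> \<noteq> id" for \<sigma>
  proof -
    obtain a b where ab: "a < b" "b < s" "\<sigma> b < \<sigma> a" using permutation_inversion[of \<sigma> s] \<sigma> by auto
    have im: "\<sigma> a < s" using \<sigma> ab permutes_in_image[of \<sigma> "{0..<s}" a] by auto
    define \<tau> where "\<tau> = \<sigma> \<circ> Transposition.transpose a b"
    have "\<tau> permutes {0..<s}"
      unfolding \<tau>_def using \<sigma> ab by (intro permutes_compose permutes_swap_id) auto
    have split: "F \<rho> = f a * g (\<rho> a) + f b * g (\<rho> b) + (\<Sum>c\<in>{0..<s} - {a, b}. f c * g (\<rho> c))" for \<rho>
    proof -
      have "F \<rho> = (\<Sum>c\<in>{a, b}. f c * g (\<rho> c)) + (\<Sum>c\<in>{0..<s} - {a, b}. f c * g (\<rho> c))"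
        unfolding F_def using ab by (subst sum.subset_diff[of "{a, b}"]) auto
      then show ?thesis using ab by simp
    qed
    have "(\<Sum>c\<in>{0..<s} - {a, b}. f c * g (\<tau> c)) = (\<Sum>c\<in>{0..<s} - {a, b}. f c * g (\<sigma> c))"
      by (rule sum.cong) (auto simp: \<tau>_def Transposition.transpose_def)
    moreover have "\<tau> a = \<sigma> b" "\<tau> b = \<sigma> a" by (auto simp: \<tau>_def)
    \<comment> \<open>The two sides differ by the product of the positive increments f b - f a and g
      (\<sigma> a) - g (\<sigma> b).\<close>
    moreover have "f a * g (\<sigma> a) + f b * g (\<sigma> b) < f a * g (\<sigma> b) + f b * g (\<sigma> a)"
    proof -
      obtain x y where "f b = f a + Suc x" "g (\<sigma> a) = g (\<sigma> b) + Suc y"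
        using mono[of a b] mono[of "\<sigma> b" "\<sigma> a"] ab im by (metis less_iff_Suc_add add_Suc_right)
      then show ?thesis by (simp add: algebra_simps)
    qed
    ultimately have "F \<sigma> < F \<tau>" unfolding split[of \<sigma>] split[of \<tau>] by simp
    then show ?thesis using \<open>\<tau> permutes _\<close> by blast
  qed
  have fin: "finite (F ` ?P)" "F ` ?P \<noteq> {}"
    using finite_permutations[of "{0..<s}"] by (auto intro: permutes_id)
  obtain \<rho> where \<rho>: "\<rho> \<in> ?P" "F \<rho> = Max (F ` ?P)" using Max_in[OF fin] by auto
  have max: "F \<tau> \<le> F \<rho>" if "\<tau> \<in> ?P" for \<tau>
    unfolding \<rho>(2) by (rule Max_ge) (use fin that in auto)
  have "\<rho> = id" using step[OF \<rho>(1)] max by (meson not_le)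
  moreover have "F \<sigma> < F \<rho>" using step[of \<sigma>] \<sigma> max by (metis less_le_trans mem_Collect_eq)
  ultimately show ?thesis by (simp add: F_def)
qed

section \<open>Exponent vectors, linear dependence and weights\<close>

text \<open>Restriction to \<open>A\<close> identifies these exponent vectors with the functions
  from \<open>A\<close> to \<open>{..e}\<close>.\<close>

lemma box_card:
  assumes "finite A"
  shows "finite {s :: 'v \<Rightarrow>\<^sub>0 nat. Poly_Mapping.keys s \<subseteq> A \<and> (\<forall>v. Poly_Mapping.lookup s v \<le> e)}" (is "finite ?B")
    and "card {s :: 'v \<Rightarrow>\<^sub>0 nat. Poly_Mapping.keys s \<subseteq> A \<and> (\<forall>v. Poly_Mapping.lookup s v \<le> e)} = (e + 1) ^ card A"
proof -
  let ?h = "\<lambda>s :: 'v \<Rightarrow>\<^sub>0 nat. restrict (Poly_Mapping.lookup s) A"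
  let ?g = "\<lambda>f. Abs_poly_mapping (\<lambda>v. if v \<in> A then f v else 0 :: nat)"
  have lookup_g: "Poly_Mapping.lookup (?g f) = (\<lambda>v. if v \<in> A then f v else 0)" for f
    by (rule lookup_Abs_poly_mapping) (rule finite_subset[OF _ assms], auto)
  have bij: "bij_betw ?h ?B (PiE A (\<lambda>_. {..e}))"
  proof (rule bij_betw_byWitness[where f' = ?g])
    show "\<forall>s\<in>?B. ?g (?h s) = s"
    proof
      fix s assume "s \<in> ?B"
      then show "?g (?h s) = s"
        by (intro poly_mapping_eqI) (auto simp: lookup_g in_keys_iff)
    qed
    show "\<forall>f\<in>PiE A (\<lambda>_. {..e}). ?h (?g f) = f"
      by (auto simp: lookup_g restrict_def PiE_def extensional_def fun_eq_iff)
    show "?g ` PiE A (\<lambda>_. {..e}) \<subseteq> ?B"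
      by (auto simp: lookup_g in_keys_iff PiE_def Pi_def split: if_splits)
  qed auto
  then show "finite ?B" using bij_betw_finite[OF bij] assms by (simp add: finite_PiE)
  show "card ?B = (e + 1) ^ card A"
    using bij_betw_same_card[OF bij] assms by (simp add: card_PiE)
qed

text \<open>Stated for families because different monomials may have the same normal form. A
  repeated member gives a relation with coefficients 1 and -1; an injective family is too large to
  be independent in the span of \<open>T\<close>.\<close>

lemma (in vector_space) family_dependent:
  assumes "finite A" "finite T" "card T < card A" "\<And>a. a \<in> A \<Longrightarrow> q a \<in> span T"
  shows "\<exists>c. (\<exists>a\<in>A. c a \<noteq> 0) \<and> (\<Sum>a\<in>A. scale (c a) (q a)) = 0"
proof (cases "inj_on q A")
  case True
  have "\<not> independent (q ` A)"
  proof
    assume "independent (q ` A)"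
    then have "card (q ` A) \<le> card T"
      using independent_span_bound[OF assms(2)] assms(4) by blast
    then show False using assms(3) True by (simp add: card_image)
  qed
  then obtain u where u: "\<exists>v\<in>q ` A. u v \<noteq> 0" "(\<Sum>v\<in>q ` A. scale (u v) v) = 0"
    using dependent_finite[of "q ` A"] assms(1) by auto
  then show ?thesis
    using True by (intro exI[of _ "u \<circ> q"]) (auto simp: sum.reindex)
next
  case False
  then obtain a b where ab: "a \<in> A" "b \<in> A" "a \<noteq> b" "q a = q b" by (auto simp: inj_on_def)
  define c :: "_ \<Rightarrow> 'a" where "c = (\<lambda>x. if x = a then 1 else if x = b then - 1 else 0)"
  have "(\<Sum>x\<in>A. scale (c x) (q x)) = (\<Sum>x\<in>{a, b}. scale (c x) (q x))"
    using ab assms(1) by (intro sum.mono_neutral_right) (auto simp: c_def)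
  also have "\<dots> = 0" using ab by (simp add: c_def)
  finally show ?thesis using ab by (intro exI[of _ c]) (auto simp: c_def)
qed

interpretation mpoly: vector_space "\<lambda>(c::'k::field) (p::('v, 'k) mpoly). mpoly_const c * p"
proof unfold_locales
  fix a b :: 'k and x y :: "('v, 'k) mpoly"
  show "mpoly_const a * (x + y) = mpoly_const a * x + mpoly_const a * y"
    by (rule distrib_left)
  show "mpoly_const (a + b) * x = mpoly_const a * x + mpoly_const b * x"
    by (simp add: mpoly_const_def single_add distrib_right)
  show "mpoly_const a * (mpoly_const b * x) = mpoly_const (a * b) * x"
    by (simp add: mpoly_const_def mult_single mult.assoc[symmetric])
  show "mpoly_const 1 * x = x"
    by (simp add: mpoly_const_def)
qed

text \<open>Constant weight 1 gives the degree in the variables of \<open>V\<close>; the weight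
  \<open>i * j\<close> drives the induction in \<open>straightening\<close>.\<close>

definition wsum :: "'v set \<Rightarrow> ('v \<Rightarrow> nat) \<Rightarrow> ('v \<Rightarrow>\<^sub>0 nat) \<Rightarrow> nat" where
  "wsum V c t = (\<Sum>v\<in>V. c v * Poly_Mapping.lookup t v)"

lemma wsum_add: "wsum V c (s + t) = wsum V c s + wsum V c t"
  by (simp add: wsum_def lookup_add distrib_left sum.distrib)

lemma wsum_sum: "wsum V c (sum h A) = (\<Sum>a\<in>A. wsum V c (h a))"
  by (induction A rule: infinite_finite_induct) (simp_all add: wsum_add, simp_all add: wsum_def)

lemma wsum_single: "finite V \<Longrightarrow> v \<in> V \<Longrightarrow> wsum V c (Poly_Mapping.single v 1) = c v"
  by (simp add: wsum_def lookup_single when_def if_distrib cong: if_cong)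

section \<open>Straightening modulo the minors\<close>

text \<open>The increasing maps \<open>f\<close> and \<open>g\<close> list the chosen rows and
  columns in order, so \<open>pick\<close> gives them back and the sum is the Leibniz expansion of a
  generator.\<close>

lemma det_ideal_chain_minor:
  assumes mono: "\<And>a b. a < b \<Longrightarrow> b < r + 1 \<Longrightarrow> f a < f b \<and> g a < g b"
    and mem: "\<And>a. a < r + 1 \<Longrightarrow> f a < m \<and> g a < n"
  shows "(\<Sum>\<sigma> | \<sigma> permutes {0..<r + 1}. signof \<sigma> *
    Poly_Mapping.single (\<Sum>a = 0..<r + 1. Poly_Mapping.single (f a, g (\<sigma> a)) 1) 1)
      \<in> (det_ideal r m n :: (nat \<times> nat, 'k::field) mpoly set)"
proof -
  \<comment> \<open>Exactly \<open>a\<close> elements of the image lie below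
    \<open>h a\<close>.\<close>
  have pick: "pick (h ` {0..<r + 1}) a = h a"
    if h: "\<And>a b. a < b \<Longrightarrow> b < r + 1 \<Longrightarrow> h a < h b" and "a < r + 1" for a and h :: "nat \<Rightarrow> nat"
  proof -
    have iff: "h b < h a \<longleftrightarrow> b < a" if "b < r + 1" for b
      using h[of a b] h[of b a] that \<open>a < r + 1\<close> by (cases a b rule: linorder_cases) auto
    have "{x \<in> h ` {0..<r + 1}. x < h a} = h ` {0..<a}"
      using iff \<open>a < r + 1\<close> by auto
    moreover have "inj_on h {0..<a}"
    proof (rule linorder_inj_onI')
      fix i j assume "i \<in> {0..<a}" "j \<in> {0..<a}" "i < j"
      then show "h i \<noteq> h j" using h[of i j] \<open>a < r + 1\<close> by simp
    qed
    ultimately have "card {x \<in> h ` {0..<r + 1}. x < h a} = a" by (simp add: card_image)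
    then show ?thesis using pick_card_in_set[of "h a" "h ` {0..<r + 1}"] \<open>a < r + 1\<close> by auto
  qed
  have inj: "inj_on f {0..<r + 1}" "inj_on g {0..<r + 1}"
    by (rule linorder_inj_onI'; use mono in force)+
  let ?I = "f ` {0..<r + 1}" and ?J = "g ` {0..<r + 1}"
  let ?d = "det (submatrix (generic_mat m n) ?I ?J) :: (nat \<times> nat, 'k) mpoly"
  interpret R: cring "mpoly_ring (grid m n) :: (nat \<times> nat, 'k) mpoly ring" by (rule cring_mpoly_ring)
  have IJ: "?I \<subseteq> {..<m}" "?J \<subseteq> {..<n}" "card ?I = r + 1" "card ?J = r + 1"
    using mem inj by (auto simp: card_image)
  then have "?d \<in> minors (r + 1) (generic_mat m n)"
    unfolding minors_def by (auto simp: generic_mat_def)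
  then have "?d \<in> det_ideal r m n"
    unfolding det_ideal_def det_poly_ring_def
    using R.genideal_self minors_generic_mat_subset[unfolded det_poly_ring_def] by blast
  moreover have "?d = (\<Sum>\<sigma> | \<sigma> permutes {0..<r + 1}. signof \<sigma> *
      Poly_Mapping.single (\<Sum>a = 0..<r + 1. Poly_Mapping.single (f a, g (\<sigma> a)) 1) 1)"
    unfolding generic_minor[OF IJ]
  proof (intro sum.cong refl arg_cong2[of _ _ _ _ "(*)"])
    fix \<sigma> assume "\<sigma> \<in> {\<sigma>. \<sigma> permutes {0..<r + 1}}"
    then have im: "\<sigma> a < r + 1" if "a < r + 1" for a
      using permutes_in_image[of \<sigma> "{0..<r + 1}" a] that by auto
    have "(\<Prod>a = 0..<r + 1. mpoly_var (pick ?I a, pick ?J (\<sigma> a)) :: (nat \<times> nat, 'k) mpoly)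
        = (\<Prod>a = 0..<r + 1. Poly_Mapping.single (Poly_Mapping.single (f a, g (\<sigma> a)) 1) 1)"
    proof (intro prod.cong refl)
      fix a assume "a \<in> {0..<r + 1}"
      then have "a < r + 1" by simp
      then have "pick ?I a = f a" "pick ?J (\<sigma> a) = g (\<sigma> a)"
        using mono im by (intro pick; blast)+
      then show "mpoly_var (pick ?I a, pick ?J (\<sigma> a)) =
          (Poly_Mapping.single (Poly_Mapping.single (f a, g (\<sigma> a)) 1) 1 :: (nat \<times> nat, 'k) mpoly)"
        by (simp only: mpoly_var_def)
    qed
    also have "\<dots> = Poly_Mapping.single (\<Sum>a = 0..<r + 1. Poly_Mapping.single (f a, g (\<sigma> a)) 1) 1"
      by (rule single_prod)
    finally show "(\<Prod>a = 0..<r + 1. mpoly_var (pick ?I a, pick ?J (\<sigma> a)) :: (nat \<times> nat, 'k) mpoly)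
        = Poly_Mapping.single (\<Sum>a = 0..<r + 1. Poly_Mapping.single (f a, g (\<sigma> a)) 1) 1" .
  qed
  ultimately show ?thesis by simp
qed

lemma mpoly_const_in_ring [simp]: "mpoly_const c \<in> carrier (mpoly_ring V)"
  by (simp add: mpoly_const_def mpoly_ring_carrier_iff)

lemma
  fixes p q :: "(nat \<times> nat, 'k::field) mpoly"
  shows det_ideal_zero: "0 \<in> (det_ideal r m n :: (nat \<times> nat, 'k) mpoly set)"
    and det_ideal_add: "p \<in> det_ideal r m n \<Longrightarrow> q \<in> det_ideal r m n \<Longrightarrow> p + q \<in> det_ideal r m n"
    and det_ideal_mult: "p \<in> det_ideal r m n \<Longrightarrow> x \<in> carrier (mpoly_ring (grid m n)) \<Longrightarrow> x * p \<in> det_ideal r m n"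
    and det_ideal_scale: "p \<in> det_ideal r m n \<Longrightarrow> mpoly_const c * p \<in> det_ideal r m n"
proof -
  let ?R = "mpoly_ring (grid m n) :: (nat \<times> nat, 'k) mpoly ring"
  interpret I: ideal "det_ideal r m n" ?R by (rule ideal_det_ideal)
  show "0 \<in> (det_ideal r m n :: (nat \<times> nat, 'k) mpoly set)" using additive_subgroup.zero_closed[OF I.additive_subgroup_axioms] by simp
  show "p + q \<in> det_ideal r m n" if "p \<in> det_ideal r m n" "q \<in> det_ideal r m n"
    using additive_subgroup.a_closed[OF I.additive_subgroup_axioms that] by simp
  show mult: "x * p \<in> det_ideal r m n" if "p \<in> det_ideal r m n" "x \<in> carrier ?R" for x
    using I.I_l_closed[OF that] by simp
  show "mpoly_const c * p \<in> det_ideal r m n" if "p \<in> det_ideal r m n"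
    by (rule mult[OF that]) simp
qed

lemma signof_mult: "signof \<sigma> * p = mpoly_const (signof \<sigma>) * (p :: ('v, 'k::field) mpoly)"
  by (simp add: sign_def mpoly_const_def single_uminus)

text \<open>A chain in the support means that the diagonal term of a minor of size
  \<open>r + 1\<close> divides the monomial. The degree bound \<open>d\<close> makes the set finite
  for the dimension count.\<close>

definition standard_monomials :: "nat \<Rightarrow> nat set \<Rightarrow> nat set \<Rightarrow> nat \<Rightarrow> (nat \<times> nat \<Rightarrow>\<^sub>0 nat) set" where
  "standard_monomials r S T d = {s. Poly_Mapping.keys s \<subseteq> S \<times> T \<and>
     \<not> has_chain (r + 1) (Poly_Mapping.keys s) \<and> wsum (S \<times> T) (\<lambda>_. 1) s \<le> d}"

text \<open>If the support contains a chain, the minor on it times the remaining monomial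
  \<open>u\<close> lies in the ideal. It rewrites \<open>t\<close> by terms of the same degree,
  still inside \<open>S \<times> T\<close>, of smaller weight for \<open>i * j\<close>; the
  induction is on this weight.\<close>

lemma straightening:
  fixes t :: "nat \<times> nat \<Rightarrow>\<^sub>0 nat"
  assumes S: "S \<subseteq> {..<m}" and T: "T \<subseteq> {..<n}"
    and "Poly_Mapping.keys t \<subseteq> S \<times> T" "wsum (S \<times> T) (\<lambda>_. 1) t \<le> d"
  shows "\<exists>q \<in> mpoly.span ((\<lambda>s. Poly_Mapping.single s 1) ` standard_monomials r S T d).
    (Poly_Mapping.single t 1 :: (nat \<times> nat, 'k::field) mpoly) - q \<in> det_ideal r m n"
  using assms(3,4)
proof (induction "wsum (S \<times> T) (\<lambda>(i, j). i * j) t" arbitrary: t rule: less_induct)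
  case less
  let ?span = "mpoly.span ((\<lambda>s. Poly_Mapping.single s 1) ` standard_monomials r S T d) :: (nat \<times> nat, 'k) mpoly set"
  let ?I = "det_ideal r m n :: (nat \<times> nat, 'k) mpoly set"
  have fin: "finite (S \<times> T)" using finite_subset[OF S] finite_subset[OF T] by simp
  \<comment> \<open>The polynomials congruent to a combination of standard monomials.
    \<open>K\<close> contains the ideal and is closed under linear combinations.\<close>
  define K where "K = {p :: (nat \<times> nat, 'k) mpoly. \<exists>q\<in>?span. p - q \<in> ?I}"
  have K_ideal: "p \<in> K" if "p \<in> ?I" for p
    unfolding K_def using that mpoly.span_zero by (auto intro!: bexI[of _ 0])
  have K_add: "p + p' \<in> K" if K: "p \<in> K" "p' \<in> K" for p p'
  proof -
    obtain q q' where "q \<in> ?span" "q' \<in> ?span" "p - q \<in> ?I" "p' - q' \<in> ?I"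
      using K unfolding K_def by blast
    moreover have "p + p' - (q + q') = (p - q) + (p' - q')" by simp
    ultimately show ?thesis
      unfolding K_def by (metis (mono_tags, lifting) CollectI det_ideal_add mpoly.span_add)
  qed
  have K_scale: "mpoly_const c * p \<in> K" if K: "p \<in> K" for p c
  proof -
    obtain q where "q \<in> ?span" "p - q \<in> ?I" using K unfolding K_def by blast
    moreover have "mpoly_const c * p - mpoly_const c * q = mpoly_const c * (p - q)"
      by (simp add: right_diff_distrib)
    ultimately show ?thesis
      unfolding K_def by (metis (mono_tags, lifting) CollectI det_ideal_scale mpoly.span_scale)
  qed
  have K_sum: "sum h A \<in> K" if "\<And>a. a \<in> A \<Longrightarrow> h a \<in> K" for h and A :: "(nat \<Rightarrow> nat) set"
    using that by (induction A rule: infinite_finite_induct) (auto intro: K_add K_ideal det_ideal_zero)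
  have "Poly_Mapping.single t 1 \<in> K"
  proof (cases "has_chain (r + 1) (Poly_Mapping.keys t)")
    case False
    then have "t \<in> standard_monomials r S T d" using less.prems by (simp add: standard_monomials_def)
    then show ?thesis unfolding K_def
      by (auto intro!: bexI[of _ "Poly_Mapping.single t 1"] mpoly.span_base det_ideal_zero)
  next
    case True
    then obtain f g where mono: "\<And>a b. a < b \<Longrightarrow> b < r + 1 \<Longrightarrow> f a < f b \<and> g a < g b"
      and mem: "\<And>a. a < r + 1 \<Longrightarrow> (f a, g a) \<in> Poly_Mapping.keys t"
      unfolding has_chain_def by blast
    have ST: "f a \<in> S" "g a \<in> T" if "a < r + 1" for a
      using mem[OF that] less.prems(1) by auto
    \<comment> \<open>\<open>E \<sigma>\<close> is the exponent vector of the Leibniz term of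
      \<open>\<sigma>\<close> for the minor on the chain; \<open>E id\<close> is the diagonal term,
      which divides \<open>t\<close>.\<close>
    define E where "E = (\<lambda>\<sigma>. \<Sum>a = 0..<r + 1. Poly_Mapping.single (f a, g (\<sigma> a)) (1::nat))"
    define u where "u = t - E id"
    let ?P = "{\<sigma>. \<sigma> permutes {0..<r + 1}}"
    have finP: "finite ?P" by (simp add: finite_permutations)
    \<comment> \<open>The positions of the chain are distinct, so \<open>E id\<close> has exponents
      at most 1, and \<open>t\<close> has positive exponents there.\<close>
    have le: "Poly_Mapping.lookup (E id) v \<le> Poly_Mapping.lookup t v" for v
    proof -
      have lookup_E: "Poly_Mapping.lookup (E id) v = (\<Sum>a = 0..<r + 1. if (f a, g a) = v then 1 else 0)"
        by (simp only: E_def lookup_sum lookup_single when_def id_apply)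
      show ?thesis
      proof (cases "\<exists>b<r + 1. v = (f b, g b)")
        case True
        then obtain b where b: "b < r + 1" "v = (f b, g b)" by blast
        have "f a \<noteq> f b" if "a < r + 1" "a \<noteq> b" for a
          using mono[of a b] mono[of b a] that b(1) by (cases a b rule: linorder_cases) auto
        then have "Poly_Mapping.lookup (E id) v = (\<Sum>a = 0..<r + 1. if a = b then 1 else 0)"
          unfolding lookup_E using b(2) by (intro sum.cong) auto
        also have "\<dots> = 1" using b(1) by simp
        also have "1 \<le> Poly_Mapping.lookup t v" using mem[OF b(1)] b(2) by (auto simp: in_keys_iff)
        finally show ?thesis .
      next
        case False
        then have "Poly_Mapping.lookup (E id) v = 0" unfolding lookup_E by (intro sum.neutral) auto
        then show ?thesis by simp
      qed
    qed
    have t: "t = u + E id"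
      by (rule poly_mapping_eqI) (simp add: u_def lookup_add lookup_minus le)
    have keys_u: "Poly_Mapping.keys u \<subseteq> S \<times> T"
    proof
      fix v assume "v \<in> Poly_Mapping.keys u"
      then have "v \<in> Poly_Mapping.keys t" by (simp add: u_def in_keys_iff lookup_minus)
      then show "v \<in> S \<times> T" using less.prems by blast
    qed
    have im: "\<sigma> a < r + 1" if "\<sigma> \<in> ?P" "a < r + 1" for \<sigma> a
      using permutes_in_image[of \<sigma> "{0..<r + 1}" a] that by auto
    have wsum_E: "wsum (S \<times> T) c (E \<sigma>) = (\<Sum>a = 0..<r + 1. c (f a, g (\<sigma> a)))" if \<sigma>: "\<sigma> \<in> ?P" for c \<sigma>
      unfolding E_def wsum_sum
    proof (intro sum.cong refl)
      fix a assume "a \<in> {0..<r + 1}"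
      then show "wsum (S \<times> T) c (Poly_Mapping.single (f a, g (\<sigma> a)) 1) = c (f a, g (\<sigma> a))"
        using ST im[OF \<sigma>] by (intro wsum_single fin) auto
    qed
    have id: "id \<in> ?P" by (simp add: permutes_id)
    have smaller: "Poly_Mapping.single (u + E \<sigma>) 1 \<in> K" if \<sigma>: "\<sigma> \<in> ?P - {id}" for \<sigma>
    proof -
      have \<sigma>': "\<sigma> \<in> ?P" "\<sigma> permutes {0..<r + 1}" "\<sigma> \<noteq> id" using \<sigma> by auto
      have "wsum (S \<times> T) (\<lambda>(i, j). i * j) (E \<sigma>) < wsum (S \<times> T) (\<lambda>(i, j). i * j) (E id)"
        unfolding wsum_E[OF \<sigma>'(1)] wsum_E[OF id]
        using strict_rearrangement[of "r + 1" f g, OF mono \<sigma>'(2,3)] by simp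
      moreover have "wsum (S \<times> T) (\<lambda>_. 1) (u + E \<sigma>) = wsum (S \<times> T) (\<lambda>_. 1) t"
        unfolding t wsum_add wsum_E[OF \<sigma>'(1)] wsum_E[OF id] by simp
      moreover have "Poly_Mapping.keys (E \<sigma>) \<subseteq> S \<times> T"
      proof
        fix v assume "v \<in> Poly_Mapping.keys (E \<sigma>)"
        then have "(\<Sum>a = 0..<r + 1. Poly_Mapping.lookup (Poly_Mapping.single (f a, g (\<sigma> a)) (1::nat)) v) \<noteq> 0"
          by (simp only: E_def in_keys_iff lookup_sum not_False_eq_True)
        then obtain a where "a \<in> {0..<r + 1}" "Poly_Mapping.lookup (Poly_Mapping.single (f a, g (\<sigma> a)) (1::nat)) v \<noteq> 0"
          by (rule sum.not_neutral_contains_not_neutral)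
        then show "v \<in> S \<times> T"
          using ST[of a] ST[of "\<sigma> a"] im[OF \<sigma>'(1), of a] by (auto simp: lookup_single when_def split: if_splits)
      qed
      then have "Poly_Mapping.keys (u + E \<sigma>) \<subseteq> S \<times> T"
        using Poly_Mapping.keys_add[of u "E \<sigma>"] keys_u by blast
      ultimately show ?thesis
        unfolding K_def mem_Collect_eq using less.prems(2)
        by (intro less.hyps) (simp_all add: t wsum_add)
    qed
    let ?m = "\<lambda>s. Poly_Mapping.single s 1 :: (nat \<times> nat, 'k) mpoly"
    have "(\<Sum>\<sigma>\<in>?P. signof \<sigma> * ?m (E \<sigma>)) \<in> ?I"
      unfolding E_def
    proof (rule det_ideal_chain_minor[OF mono])
      show "f a < m \<and> g a < n" if "a < r + 1" for a
        using ST[OF that] S T by auto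
    qed
    moreover have "?m u \<in> carrier (mpoly_ring (grid m n))"
      using keys_u S T by (auto simp: mpoly_ring_carrier_iff)
    ultimately have "?m u * (\<Sum>\<sigma>\<in>?P. signof \<sigma> * ?m (E \<sigma>)) \<in> K"
      by (intro K_ideal det_ideal_mult)
    moreover have "?m u * (signof \<sigma> * ?m (E \<sigma>)) = mpoly_const (signof \<sigma>) * ?m (u + E \<sigma>)" for \<sigma>
    proof -
      have "?m u * ?m (E \<sigma>) = ?m (u + E \<sigma>)" by (simp add: mult_single)
      then show ?thesis unfolding signof_mult by (metis mult.left_commute)
    qed
    ultimately have "(\<Sum>\<sigma>\<in>?P. mpoly_const (signof \<sigma>) * ?m (u + E \<sigma>)) \<in> K"
      by (simp add: sum_distrib_left)
    moreover have "(\<Sum>\<sigma>\<in>?P. mpoly_const (signof \<sigma>) * ?m (u + E \<sigma>)) =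
        ?m t + (\<Sum>\<sigma>\<in>?P - {id}. mpoly_const (signof \<sigma>) * ?m (u + E \<sigma>))"
      by (subst sum.remove[OF finP id]) (simp add: t mpoly_const_def sign_id)
    ultimately have total: "?m t + (\<Sum>\<sigma>\<in>?P - {id}. mpoly_const (signof \<sigma>) * ?m (u + E \<sigma>)) \<in> K"
      by simp
    have "(\<Sum>\<sigma>\<in>?P - {id}. mpoly_const (signof \<sigma>) * ?m (u + E \<sigma>)) \<in> K"
      by (intro K_sum K_scale smaller)
    from K_scale[OF this, of "- 1"] have "- (\<Sum>\<sigma>\<in>?P - {id}. mpoly_const (signof \<sigma>) * ?m (u + E \<sigma>)) \<in> K"
      by (simp add: mpoly_const_def single_uminus)
    from K_add[OF total this] show ?thesis by simp
  qed
  then show ?case unfolding K_def by simp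
qed

section \<open>Dimension count\<close>

text \<open>By \<open>chain_free_card\<close> each support has at most
  \<open>r * (card S + card T - r)\<close> elements. There are at most
  \<open>2 ^ card (S \<times> T)\<close> supports, and on each the exponents are bounded by
  \<open>d\<close>.\<close>

lemma standard_monomials_card:
  assumes "finite S" "finite T" "r \<le> card S" "r \<le> card T"
  shows "finite (standard_monomials r S T d)"
    and "card (standard_monomials r S T d) \<le> 2 ^ card (S \<times> T) * (d + 1) ^ (r * (card S + card T - r))"
proof -
  let ?D = "r * (card S + card T - r)"
  let ?box = "\<lambda>A. {s :: nat \<times> nat \<Rightarrow>\<^sub>0 nat. Poly_Mapping.keys s \<subseteq> A \<and> (\<forall>v. Poly_Mapping.lookup s v \<le> d)}"
  let ?F = "{A. A \<subseteq> S \<times> T \<and> card A \<le> ?D}"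
  have fin: "finite (S \<times> T)" using assms by simp
  have finF: "finite ?F" using fin by simp
  have finA: "finite A" if "A \<in> ?F" for A using that fin finite_subset by blast
  have sub: "standard_monomials r S T d \<subseteq> (\<Union>A\<in>?F. ?box A)"
  proof
    fix s assume s: "s \<in> standard_monomials r S T d"
    then have keys: "Poly_Mapping.keys s \<subseteq> S \<times> T" "\<not> has_chain (r + 1) (Poly_Mapping.keys s)"
      and deg: "(\<Sum>v\<in>S \<times> T. Poly_Mapping.lookup s v) \<le> d"
      by (auto simp: standard_monomials_def wsum_def)
    have "card (Poly_Mapping.keys s) + r * r \<le> r * (card S + card T)"
      by (rule chain_free_card[OF assms(1,2) keys assms(3,4)])
    then have "card (Poly_Mapping.keys s) \<le> ?D" by (simp add: diff_mult_distrib2)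
    moreover have "Poly_Mapping.lookup s v \<le> d" for v
    proof (cases "v \<in> S \<times> T")
      case True
      have "Poly_Mapping.lookup s v \<le> (\<Sum>v\<in>S \<times> T. Poly_Mapping.lookup s v)"
        using True fin by (intro member_le_sum) auto
      with deg show ?thesis by simp
    next
      case False
      then have "v \<notin> Poly_Mapping.keys s" using keys by blast
      then show ?thesis by (simp add: in_keys_iff)
    qed
    ultimately show "s \<in> (\<Union>A\<in>?F. ?box A)" using keys by blast
  qed
  have finU: "finite (\<Union>A\<in>?F. ?box A)" using finF finA box_card(1) by blast
  show "finite (standard_monomials r S T d)" using sub finU by (rule finite_subset)
  have "card (standard_monomials r S T d) \<le> card (\<Union>A\<in>?F. ?box A)"
    by (rule card_mono[OF finU sub])
  also have "\<dots> \<le> (\<Sum>A\<in>?F. card (?box A))" by (rule card_UN_le[OF finF])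
  also have "\<dots> \<le> (\<Sum>A\<in>?F. (d + 1) ^ ?D)"
  proof (rule sum_mono)
    fix A assume A: "A \<in> ?F"
    have "card (?box A) = (d + 1) ^ card A" by (rule box_card(2)[OF finA[OF A]])
    also have "\<dots> \<le> (d + 1) ^ ?D" using A by (intro power_increasing) auto
    finally show "card (?box A) \<le> (d + 1) ^ ?D" .
  qed
  also have "\<dots> = card ?F * (d + 1) ^ ?D" by simp
  also have "\<dots> \<le> 2 ^ card (S \<times> T) * (d + 1) ^ ?D"
  proof (rule mult_right_mono)
    have "card ?F \<le> card (Pow (S \<times> T))" using fin by (intro card_mono) auto
    then show "card ?F \<le> 2 ^ card (S \<times> T)" using fin by (simp add: card_Pow)
  qed simp
  finally show "card (standard_monomials r S T d) \<le> 2 ^ card (S \<times> T) * (d + 1) ^ ?D" .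
qed

text \<open>Monomials in \<open>\<Omega>\<close> with exponents up to \<open>e\<close> number
  \<open>(e + 1) ^ card \<Omega>\<close>, while their normal forms span a space whose dimension
  grows with a smaller power of \<open>e\<close>. A linear relation among the normal forms makes the
  same combination of monomials lie in the ideal, and it is nonzero because the monomials are
  distinct.\<close>

lemma det_ideal_elimination:
  assumes S: "S \<subseteq> {..<m}" and T: "T \<subseteq> {..<n}" and r: "r \<le> card S" "r \<le> card T"
    and \<Omega>: "\<Omega> \<subseteq> S \<times> T" "r * (card S + card T - r) < card \<Omega>"
  shows "\<exists>p :: (nat \<times> nat, 'k::field) mpoly. p \<in> carrier (mpoly_ring \<Omega>) \<and> p \<in> det_ideal r m n \<and> p \<noteq> 0"
proof -
  have finS: "finite S" "finite T" using finite_subset[OF S] finite_subset[OF T] by simp_all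
  then have fin: "finite (S \<times> T)" by simp
  have fin\<Omega>: "finite \<Omega>" using \<Omega> fin finite_subset by blast
  let ?N = "card \<Omega>" and ?D = "r * (card S + card T - r)" and ?G = "2 ^ card (S \<times> T) :: nat"
  \<comment> \<open>This \<open>e\<close> turns the estimate below into
    \<open>e * (e + 1) ^ ?D\<close>, less than \<open>(e + 1) ^ (?D + 1)\<close>; \<open>d\<close>
    bounds the degrees of the monomials in the box.\<close>
  define e where "e = ?G * ?N ^ ?D"
  define d where "d = ?N * e"
  let ?A = "{s :: nat \<times> nat \<Rightarrow>\<^sub>0 nat. Poly_Mapping.keys s \<subseteq> \<Omega> \<and> (\<forall>v. Poly_Mapping.lookup s v \<le> e)}"
  let ?m = "\<lambda>s. Poly_Mapping.single s 1 :: (nat \<times> nat, 'k) mpoly"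
  let ?B = "standard_monomials r S T d"
  have "?N \<ge> 1" using \<Omega>(2) by simp
  have "card (?m ` ?B) \<le> card ?B"
    by (rule card_image_le) (rule standard_monomials_card(1)[OF finS r])
  also have "\<dots> \<le> ?G * (d + 1) ^ ?D" by (rule standard_monomials_card(2)[OF finS r])
  also have "\<dots> \<le> ?G * (?N * (e + 1)) ^ ?D"
    using \<open>?N \<ge> 1\<close> by (intro mult_left_mono power_mono) (auto simp: d_def)
  also have "\<dots> = e * (e + 1) ^ ?D" by (simp only: e_def power_mult_distrib mult.assoc)
  also have "\<dots> < (e + 1) ^ (?D + 1)" by simp
  also have "\<dots> \<le> (e + 1) ^ ?N" using \<Omega>(2) by (intro power_increasing) auto
  also have "\<dots> = card ?A" by (rule box_card(2)[OF fin\<Omega>, symmetric])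
  finally have less: "card (?m ` ?B) < card ?A" .
  have "\<exists>q \<in> mpoly.span (?m ` ?B). ?m s - q \<in> det_ideal r m n" if s: "s \<in> ?A" for s
  proof (rule straightening[OF S T])
    show "Poly_Mapping.keys s \<subseteq> S \<times> T" using s \<Omega> by blast
    have "wsum (S \<times> T) (\<lambda>_. 1) s = (\<Sum>v\<in>\<Omega>. Poly_Mapping.lookup s v)"
      unfolding wsum_def using s \<Omega>(1) fin by (intro sum.mono_neutral_cong_right) (auto simp: in_keys_iff)
    also have "\<dots> \<le> (\<Sum>v\<in>\<Omega>. e)" using s by (intro sum_mono) auto
    finally show "wsum (S \<times> T) (\<lambda>_. 1) s \<le> d" by (simp add: d_def)
  qed
  then have "\<forall>s\<in>?A. \<exists>q. q \<in> mpoly.span (?m ` ?B) \<and> ?m s - q \<in> det_ideal r m n" by blast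
  from bchoice[OF this] obtain q where q: "\<And>s. s \<in> ?A \<Longrightarrow> q s \<in> mpoly.span (?m ` ?B)"
    "\<And>s. s \<in> ?A \<Longrightarrow> ?m s - q s \<in> det_ideal r m n" by blast
  have finA: "finite ?A" by (rule box_card(1)[OF fin\<Omega>])
  have finB: "finite (?m ` ?B)" using standard_monomials_card(1)[OF finS r] by simp
  have "\<exists>c. (\<exists>s\<in>?A. c s \<noteq> 0) \<and> (\<Sum>s\<in>?A. mpoly_const (c s) * q s) = 0"
    by (rule mpoly.family_dependent[OF finA finB less q(1)])
  then obtain c where c: "\<exists>s\<in>?A. c s \<noteq> 0" "(\<Sum>s\<in>?A. mpoly_const (c s) * q s) = 0"
    by (elim exE conjE)
  define p where "p = (\<Sum>s\<in>?A. mpoly_const (c s) * ?m s)"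
  have p': "p = (\<Sum>s\<in>?A. Poly_Mapping.single s (c s))"
    by (simp add: p_def mpoly_const_def mult_single)
  have lookup_p: "Poly_Mapping.lookup p s = (if s \<in> ?A then c s else 0)" for s
    using finA by (simp add: p' lookup_sum lookup_single when_def)
  \<comment> \<open>Subtracting the relation among the \<open>q s\<close> exhibits \<open>p\<close>
    as a combination of elements of the ideal.\<close>
  have "p = (\<Sum>s\<in>?A. mpoly_const (c s) * (?m s - q s))"
    using c(2) by (simp add: p_def right_diff_distrib sum_subtractf)
  moreover have "(\<Sum>s\<in>A. mpoly_const (c s) * (?m s - q s)) \<in> det_ideal r m n" if "A \<subseteq> ?A" for A
    using finite_subset[OF that finA] that
    by (induction A rule: finite_induct) (auto intro!: det_ideal_add det_ideal_scale det_ideal_zero q(2))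
  ultimately have "p \<in> det_ideal r m n" by simp
  moreover have "p \<in> carrier (mpoly_ring \<Omega>)"
    unfolding mpoly_ring_carrier_iff
  proof
    fix s assume "s \<in> Poly_Mapping.keys p"
    then have "s \<in> ?A" by (metis (no_types, lifting) in_keys_iff lookup_p)
    then show "Poly_Mapping.keys s \<subseteq> \<Omega>" by blast
  qed
  moreover have "p \<noteq> 0"
  proof -
    obtain s where "s \<in> ?A" "c s \<noteq> 0" using c(1) by (elim bexE)
    then have "Poly_Mapping.lookup p s \<noteq> 0" by (simp only: lookup_p if_True not_False_eq_True)
    then show ?thesis by (metis lookup_zero)
  qed
  ultimately show ?thesis by blast
qed

section \<open>Combinatorics of relaxed SLMFs\<close>

text \<open>Newton interpolation: a new node is met by adding a multiple of the product vanishing at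
  the old nodes, whose degree is at most their number. Thus up to \<open>r\<close> entries of a
  column can be prescribed freely.\<close>

lemma interpolating_poly:
  fixes t y :: "'i \<Rightarrow> 'k::field"
  assumes "finite S" "inj_on t S" "card S \<le> r" "0 < r"
  shows "\<exists>p. degree p < r \<and> (\<forall>i\<in>S. poly p (t i) = y i)"
  using assms
proof (induction S rule: finite_induct)
  case empty
  then show ?case by (intro exI[of _ 0]) simp
next
  case (insert i S)
  then obtain p where p: "degree p < r" "\<forall>i\<in>S. poly p (t i) = y i" by auto
  define q where "q = (\<Prod>s\<in>S. [:- t s, 1:])"
  define c where "c = (y i - poly p (t i)) / poly q (t i)"
  have "degree q \<le> sum (degree \<circ> (\<lambda>s. [:- t s, 1:])) S"
    unfolding q_def by (rule degree_prod_sum_le) fact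
  then have "degree q < r" using insert by simp
  moreover have "degree (smult c q) \<le> degree q" by (rule degree_smult_le)
  ultimately have "degree (p + smult c q) < r"
    using p(1) by (intro degree_add_less) auto
  moreover have "poly q (t i) \<noteq> 0"
    using insert by (auto simp: q_def poly_prod)
  moreover have "poly q (t s) = 0" if "s \<in> S" for s
    using insert.hyps that by (auto simp: q_def poly_prod)
  ultimately show ?case
    using p(2) by (intro exI[of _ "p + smult c q"]) (auto simp: c_def)
qed

text \<open>Here \<open>u\<close> is a variation of a column of the left factor, and the coefficients of \<open>w j\<close> are a
  variation of the \<open>j\<close>-th column of the right factor, the left factor being the Vandermonde matrix
  of \<open>t\<close>. The row \<open>i\<close> of the hypothesis plays the role of a leaf and is removed.\<close>

lemma peelable_solvable:
  fixes t :: "nat \<Rightarrow> 'k::field" and x :: "nat \<Rightarrow> nat \<Rightarrow> 'k"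
  assumes "inj t" "0 < r" "finite I"
    and "\<And>I'. I' \<subseteq> I \<Longrightarrow> r < card I' \<Longrightarrow> \<exists>i\<in>I'. \<forall>j\<in>J. \<forall>j'\<in>J.
      i \<in> \<omega> j \<and> r < card (\<omega> j \<inter> I') \<and> i \<in> \<omega> j' \<and> r < card (\<omega> j' \<inter> I') \<longrightarrow> j = j'"
  shows "\<exists>u w. \<forall>j\<in>J. degree (w j) < r \<and> (\<forall>i\<in>\<omega> j \<inter> I. x i j = u i + poly (w j) (t i))"
  using assms(3,4)
proof (induction I rule: finite_psubset_induct)
  case (psubset I)
  \<comment> \<open>A column with at most \<open>r\<close> entries in \<open>I\<close> can be fitted
    for every \<open>u\<close>.\<close>
  have interp: "\<exists>p. degree p < r \<and> (\<forall>i\<in>\<omega> j \<inter> I. x i j = u i + poly p (t i))"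
    if "card (\<omega> j \<inter> I) \<le> r" for j u
    using interpolating_poly[of "\<omega> j \<inter> I" t r "\<lambda>i. x i j - u i"] that psubset.hyps assms(1,2)
    by (fastforce intro: inj_on_subset)
  have "\<exists>u. \<forall>j\<in>J. \<exists>p. degree p < r \<and> (\<forall>i\<in>\<omega> j \<inter> I. x i j = u i + poly p (t i))"
  proof (cases "card I \<le> r")
    case True
    then have "card (\<omega> j \<inter> I) \<le> r" for j
      using card_mono[of I "\<omega> j \<inter> I"] psubset.hyps by simp
    then show ?thesis using interp by blast
  next
    case False
    then obtain i where i: "i \<in> I" and uniq: "\<And>j j'. j \<in> J \<Longrightarrow> j' \<in> J \<Longrightarrow>
        i \<in> \<omega> j \<Longrightarrow> r < card (\<omega> j \<inter> I) \<Longrightarrow> i \<in> \<omega> j' \<Longrightarrow> r < card (\<omega> j' \<inter> I) \<Longrightarrow> j = j'"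
      using psubset.prems[of I] by auto
    have "\<exists>u w. \<forall>j\<in>J. degree (w j) < r \<and> (\<forall>i'\<in>\<omega> j \<inter> (I - {i}). x i' j = u i' + poly (w j) (t i'))"
      using i psubset.prems by (intro psubset.IH) auto
    then obtain u w where uw: "\<And>j. j \<in> J \<Longrightarrow> degree (w j) < r"
      "\<And>i' j. j \<in> J \<Longrightarrow> i' \<in> \<omega> j \<Longrightarrow> i' \<in> I \<Longrightarrow> i' \<noteq> i \<Longrightarrow> x i' j = u i' + poly (w j) (t i')"
      by blast
    \<comment> \<open>At most one column with more than \<open>r\<close> entries in \<open>I\<close>
      contains \<open>i\<close>, so the value of \<open>u\<close> at \<open>i\<close> can be fitted
      to it with \<open>w\<close> unchanged; the columns with fewer entries are interpolated
      anew.\<close>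
    have "\<exists>c. \<forall>j\<in>J. i \<in> \<omega> j \<and> r < card (\<omega> j \<inter> I) \<longrightarrow> x i j = c + poly (w j) (t i)"
    proof (cases "\<exists>j\<in>J. i \<in> \<omega> j \<and> r < card (\<omega> j \<inter> I)")
      case True
      then obtain j where j: "j \<in> J" "i \<in> \<omega> j" "r < card (\<omega> j \<inter> I)" by blast
      show ?thesis
        by (rule exI[of _ "x i j - poly (w j) (t i)"]) (use uniq[OF _ j(1)] j in fastforce)
    qed auto
    then obtain c where c: "\<And>j. j \<in> J \<Longrightarrow> i \<in> \<omega> j \<Longrightarrow> r < card (\<omega> j \<inter> I) \<Longrightarrow> x i j = c + poly (w j) (t i)"
      by blast
    show ?thesis
    proof (intro exI[of _ "u(i := c)"] ballI)
      fix j assume j: "j \<in> J"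
      show "\<exists>p. degree p < r \<and> (\<forall>i'\<in>\<omega> j \<inter> I. x i' j = (u(i := c)) i' + poly p (t i'))"
      proof (cases "card (\<omega> j \<inter> I) \<le> r")
        case True then show ?thesis by (rule interp)
      next
        case False
        then show ?thesis using uw c j by (intro exI[of _ "w j"]) auto
      qed
    qed
  qed
  then obtain u where "\<forall>j\<in>J. \<exists>p. degree p < r \<and> (\<forall>i\<in>\<omega> j \<inter> I. x i j = u i + poly p (t i))" ..
  from bchoice[OF this] show ?case by blast
qed

text \<open>If every row of \<open>I\<close> met two of the columns with more than \<open>r\<close> entries in \<open>I\<close>, double counting
  would give \<open>card I + r \<le> r * (card I - r)\<close>.\<close>

lemma relaxed_SLMF_peelable:
  assumes "relaxed_SLMF 1 r m \<omega> J" "finite J" "r = 1 \<or> m \<le> r + 2"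
    and I: "I \<subseteq> {..<m}" "r < card I"
  shows "\<exists>i\<in>I. \<forall>j\<in>J. \<forall>j'\<in>J.
      i \<in> \<omega> j \<and> r < card (\<omega> j \<inter> I) \<and> i \<in> \<omega> j' \<and> r < card (\<omega> j' \<inter> I) \<longrightarrow> j = j'"
proof (rule ccontr)
  assume contra: "\<not> ?thesis"
  define B where "B = {j\<in>J. r < card (\<omega> j \<inter> I)}"
  have fin: "finite B" "finite I"
    using assms(2) I(1) finite_subset by (auto simp: B_def)
  have two: "2 \<le> card {j\<in>B. i \<in> \<omega> j}" if "i \<in> I" for i
  proof -
    obtain j j' where "j \<in> B" "j' \<in> B" "i \<in> \<omega> j" "i \<in> \<omega> j'" "j \<noteq> j'"
      using contra \<open>i \<in> I\<close> unfolding B_def by blast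
    then have "{j, j'} \<subseteq> {j\<in>B. i \<in> \<omega> j}" "card {j, j'} = 2" by auto
    then show ?thesis using card_mono[of "{j\<in>B. i \<in> \<omega> j}" "{j, j'}"] fin by simp
  qed
  have "2 * card I = (\<Sum>i\<in>I. 2)" by simp
  also have "\<dots> \<le> (\<Sum>i\<in>I. card {j\<in>B. i \<in> \<omega> j})" by (intro sum_mono two)
  also have "\<dots> = (\<Sum>i\<in>I. \<Sum>j\<in>B. of_bool (i \<in> \<omega> j))"
    using fin by (simp add: Int_def)
  also have "\<dots> = (\<Sum>j\<in>B. \<Sum>i\<in>I. of_bool (i \<in> \<omega> j))" by (rule sum.swap)
  also have "\<dots> = (\<Sum>j\<in>B. card (\<omega> j \<inter> I))"
    using fin by (simp add: Int_def conj_commute)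
  finally have lower: "2 * card I \<le> (\<Sum>j\<in>B. card (\<omega> j \<inter> I))" .
  have "(\<Sum>j\<in>B. int (card (\<omega> j \<inter> I)) - int r) =
      (\<Sum>j\<in>J. max (int (card (\<omega> j \<inter> I)) - int r) 0)"
    using assms(2) by (intro sum.mono_neutral_cong_left) (auto simp: B_def)
  also have "\<dots> \<le> int (card I) - int r"
    using assms(1) I unfolding relaxed_SLMF_def by simp
  finally have upper: "(\<Sum>j\<in>B. int (card (\<omega> j \<inter> I)) - int r) \<le> int (card I) - int r" .
  \<comment> \<open>Each column of \<open>B\<close> has excess at least 1, which bounds their number
    by the total excess.\<close>
  have "int (card B) = (\<Sum>j\<in>B. 1)" by simp
  also have "\<dots> \<le> (\<Sum>j\<in>B. int (card (\<omega> j \<inter> I)) - int r)"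
    by (rule sum_mono) (simp add: B_def)
  finally have cardB: "int (card B) \<le> int (card I) - int r" using upper by simp
  have "int (\<Sum>j\<in>B. card (\<omega> j \<inter> I)) \<le> int (card I) - int r + int r * int (card B)"
    using upper by (simp add: sum_subtractf mult.commute)
  with lower have "2 * int (card I) \<le> int (card I) - int r + int r * int (card B)"
    by linarith
  moreover have "int r * int (card B) \<le> int r * (int (card I) - int r)"
    using cardB by (intro mult_left_mono) auto
  ultimately have *: "int (card I) + int r \<le> int r * (int (card I) - int r)" by linarith
  have "card I \<le> m" using card_mono[OF _ I(1)] by simp
  then consider "r = 1" | "card I = r + 1" | "card I = r + 2"
    using assms(3) I(2) by linarith
  \<comment> \<open>In the three cases \<open>*\<close> reads card I + 1 \<le> card I - 1, then 2 r
    + 1 \<le> r, then 2 r + 2 \<le> 2 r.\<close>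
  then show False using * by cases auto
qed

section \<open>From the inequalities to a partition\<close>

text \<open>A column with at most \<open>r\<close> entries has no excess over any
  \<open>I\<close>.\<close>

lemma sum_excess_restrict:
  assumes "finite J" "B \<subseteq> J" "\<And>j. j \<in> J - B \<Longrightarrow> finite (\<omega> j) \<and> card (\<omega> j) \<le> r"
  shows "(\<Sum>j\<in>J. max (int (card (\<omega> j \<inter> I)) - int r) 0) =
    (\<Sum>j\<in>B. max (int (card (\<omega> j \<inter> I)) - int r) 0)"
proof (rule sum.mono_neutral_right)
  show "\<forall>j\<in>J - B. max (int (card (\<omega> j \<inter> I)) - int r) 0 = 0"
  proof
    fix j assume "j \<in> J - B"
    then have "card (\<omega> j \<inter> I) \<le> r"
      using assms(3)[of j] card_mono[of "\<omega> j" "\<omega> j \<inter> I"] by force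
    then show "max (int (card (\<omega> j \<inter> I)) - int r) 0 = 0" by simp
  qed
qed fact+

text \<open>The full column alone contributes \<open>card I - r\<close>, so equality holds for every
  \<open>I\<close> with more than \<open>r\<close> rows.\<close>

lemma relaxed_SLMF_full_column:
  assumes "finite J" "a \<in> J" "\<omega> a = {..<m}" "r < m"
    and "\<And>j. j \<in> J - {a} \<Longrightarrow> finite (\<omega> j) \<and> card (\<omega> j) \<le> r"
  shows "relaxed_SLMF 1 r m \<omega> J"
proof -
  have "(\<Sum>j\<in>J. max (int (card (\<omega> j \<inter> I)) - int r) 0) = max (int (card I) - int r) 0"
    if "I \<subseteq> {..<m}" for I
    using sum_excess_restrict[of J "{a}" \<omega> r I] assms that by (simp add: Int_absorb1)
  then show ?thesis
    using \<open>r < m\<close> unfolding relaxed_SLMF_def by auto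
qed

text \<open>A set \<open>I\<close> of \<open>r + 1\<close> rows omits only one row, hence contains
  \<open>a\<close> or \<open>b\<close>, and at most one of the two columns has excess 1. For all
  rows both have excess 1, and \<open>m - r = 2\<close>.\<close>

lemma relaxed_SLMF_two_columns:
  assumes "finite J" "x \<in> J" "y \<in> J" "x \<noteq> y" "m = r + 2"
    and "\<omega> x = {..<m} - {a}" "\<omega> y = {..<m} - {b}" "a < m" "b < m" "a \<noteq> b"
    and "\<And>j. j \<in> J - {x, y} \<Longrightarrow> finite (\<omega> j) \<and> card (\<omega> j) \<le> r"
  shows "relaxed_SLMF 1 r m \<omega> J"
proof -
  have eq: "(\<Sum>j\<in>J. max (int (card (\<omega> j \<inter> I)) - int r) 0) =
      max (int (card (I - {a})) - int r) 0 + max (int (card (I - {b})) - int r) 0"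
    if "I \<subseteq> {..<m}" for I
  proof -
    have "\<omega> x \<inter> I = I - {a}" "\<omega> y \<inter> I = I - {b}" using that assms by auto
    then show ?thesis using sum_excess_restrict[of J "{x, y}" \<omega> r I] assms by simp
  qed
  have top: "max (int (card ({..<m} - {a})) - int r) 0 + max (int (card ({..<m} - {b})) - int r) 0
      = int m - int r"
    using assms by simp
  have "max (int (card (I - {a})) - int r) 0 + max (int (card (I - {b})) - int r) 0 \<le> int (card I) - int r"
    if I: "I \<subseteq> {..<m}" "r + 1 \<le> card I" for I
  proof (cases "I = {..<m}")
    case True with top show ?thesis by simp
  next
    case False
    have "finite I" using I finite_subset by auto
    have "card I < m" using False I psubset_card_mono[of "{..<m}" I] by auto
    then have "card I = r + 1" using I assms by simp
    moreover have "a \<in> I \<or> b \<in> I"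
    proof (rule ccontr)
      assume "\<not> ?thesis"
      then have "I \<subseteq> {..<m} - {a, b}" using I by auto
      then have "card I \<le> card ({..<m} - {a, b})" by (intro card_mono) auto
      also have "\<dots> = r" using assms by simp
      finally show False using I by simp
    qed
    ultimately show ?thesis
      using \<open>finite I\<close> by (auto simp: card_Diff_singleton_if)
  qed
  then show ?thesis using eq top unfolding relaxed_SLMF_def by simp
qed

text \<open>Elements at distance \<open>s\<close> in the sorted list with equal \<open>\<mu>\<close> would force \<open>s + 1\<close> equal values.\<close>

lemma sorted_list_pairing:
  fixes \<mu> :: "nat \<Rightarrow> nat"
  assumes "finite N" "card N = 2 * s" "\<And>i. card {j\<in>N. \<mu> j = i} \<le> s"
  shows "\<exists>xs. distinct xs \<and> set xs = N \<and> length xs = 2 * s \<and> (\<forall>l<s. \<mu> (xs ! l) \<noteq> \<mu> (xs ! (l + s)))"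
proof -
  define xs where "xs = sort_key \<mu> (sorted_list_of_set N)"
  have xs: "distinct xs" "set xs = N" "sorted (map \<mu> xs)" "length xs = 2 * s"
    using assms(1,2) by (simp_all add: xs_def)
  have "\<mu> (xs ! l) \<noteq> \<mu> (xs ! (l + s))" if l: "l < s" for l
  proof
    assume eq: "\<mu> (xs ! l) = \<mu> (xs ! (l + s))"
    have "(!) xs ` {l..l + s} \<subseteq> {j\<in>N. \<mu> j = \<mu> (xs ! l)}"
    proof
      fix j assume "j \<in> (!) xs ` {l..l + s}"
      then obtain k where k: "j = xs ! k" "l \<le> k" "k \<le> l + s" by auto
      have "\<mu> (xs ! l) \<le> \<mu> (xs ! k)" "\<mu> (xs ! k) \<le> \<mu> (xs ! (l + s))"
        using sorted_nth_mono[OF xs(3), of l k] sorted_nth_mono[OF xs(3), of k "l + s"] k l xs(4)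
        by auto
      then show "j \<in> {j\<in>N. \<mu> j = \<mu> (xs ! l)}"
        using eq k l xs by (auto intro: nth_mem)
    qed
    moreover have "inj_on ((!) xs) {l..l + s}"
      using xs l by (auto simp: inj_on_def nth_eq_iff_index_eq)
    ultimately have "Suc s \<le> card {j\<in>N. \<mu> j = \<mu> (xs ! l)}"
      using card_mono[of "{j\<in>N. \<mu> j = \<mu> (xs ! l)}" "(!) xs ` {l..l + s}"] assms(1)
      by (simp add: card_image)
    with assms(3)[of "\<mu> (xs ! l)"] show False by simp
  qed
  with xs show ?thesis by blast
qed

text \<open>Only the columns with more than \<open>r\<close> entries have to be distributed; all the
  others are put into part 0, which exists since \<open>0 < r\<close>.\<close>

lemma SLMF_partition_of_blocks:
  assumes "0 < r" "\<forall>j<n. \<omega> j \<subseteq> {..<m}"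
    and "disjoint_family_on B {..<r}" "(\<Union>l<r. B l) = {j. j < n \<and> r < card (\<omega> j)}"
    and "\<And>l J. l < r \<Longrightarrow> finite J \<Longrightarrow> B l \<subseteq> J \<Longrightarrow>
      (\<And>j. j \<in> J - B l \<Longrightarrow> finite (\<omega> j) \<and> card (\<omega> j) \<le> r) \<Longrightarrow> relaxed_SLMF 1 r m \<omega> J"
  shows "\<exists>P :: nat \<Rightarrow> nat set. disjoint_family_on P {..<r} \<and> (\<Union>l<r. P l) = {..<n} \<and>
         (\<forall>l<r. relaxed_SLMF 1 r m \<omega> (P l))"
proof -
  define R where "R = {j. j < n \<and> card (\<omega> j) \<le> r}"
  define P where "P = (\<lambda>l. B l \<union> (if l = 0 then R else {}))"
  have sub: "B l \<subseteq> {j. j < n \<and> r < card (\<omega> j)}" if "l < r" for l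
    using assms(4) that by blast
  have "disjoint_family_on P {..<r}"
    unfolding disjoint_family_on_def
  proof (intro ballI impI)
    fix l l' assume l: "l \<in> {..<r}" "l' \<in> {..<r}" "l \<noteq> l'"
    then have "B l \<inter> B l' = {}" using assms(3) by (simp add: disjoint_family_on_def)
    moreover have "B l \<inter> R = {}" "B l' \<inter> R = {}" using sub[of l] sub[of l'] l by (auto simp: R_def)
    ultimately show "P l \<inter> P l' = {}" using l(3) by (auto simp: P_def)
  qed
  moreover have "(\<Union>l<r. P l) = {..<n}"
  proof -
    have "(\<Union>l<r. P l) = (\<Union>l<r. B l) \<union> R" using assms(1) by (auto simp: P_def split: if_splits)
    then show ?thesis using assms(4) by (auto simp: R_def)
  qed
  moreover have "relaxed_SLMF 1 r m \<omega> (P l)" if "l < r" for l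
  proof (rule assms(5)[OF that])
    show "finite (P l)" using sub[OF that] by (intro finite_subset[of "P l" "{..<n}"]) (auto simp: P_def R_def)
    show "finite (\<omega> j) \<and> card (\<omega> j) \<le> r" if "j \<in> P l - B l" for j
      using that assms(2) finite_subset[of "\<omega> j" "{..<m}"] by (auto simp: P_def R_def split: if_splits)
  qed (simp add: P_def)
  ultimately show ?thesis by blast
qed

lemma relaxed_SLMF_imp_partition:
  assumes "0 < r" "r = 1 \<or> m = r + 1 \<or> m = r + 2" "\<forall>j<n. \<omega> j \<subseteq> {..<m}"
    and slmf: "relaxed_SLMF r r m \<omega> {..<n}"
  shows "\<exists>P :: nat \<Rightarrow> nat set. disjoint_family_on P {..<r} \<and> (\<Union>l<r. P l) = {..<n} \<and>
         (\<forall>l<r. relaxed_SLMF 1 r m \<omega> (P l))"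
proof -
  define A where "A = {j. j < n \<and> \<omega> j = {..<m}}"
  have finA: "finite A" by (simp add: A_def)
  have fin: "finite (\<omega> j)" "card (\<omega> j) \<le> m" if "j < n" for j
    using assms(3) that finite_subset[of "\<omega> j" "{..<m}"] card_mono[of "{..<m}" "\<omega> j"] by auto
  have full: "\<omega> j = {..<m}" if "j < n" "card (\<omega> j) = m" for j
    using assms(3) that by (intro card_subset_eq) auto
  have total: "(\<Sum>j<n. max (int (card (\<omega> j)) - int r) 0) = int r * (int m - int r)"
  proof -
    have "\<omega> j \<inter> {..<m} = \<omega> j" if "j < n" for j using assms(3) that by auto
    then show ?thesis using slmf unfolding relaxed_SLMF_def by simp
  qed
  consider "r = 1" | "m = r + 1" | "m = r + 2" using assms(2) by auto
  then show ?thesis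
  proof cases
    case 1
    then have "{..<r} = {0}" by auto
    then show ?thesis
      using slmf 1 by (intro exI[of _ "\<lambda>_. {..<n}"]) (simp add: disjoint_family_on_def)
  next
    case 2
    have "r < card (\<omega> j) \<longleftrightarrow> \<omega> j = {..<m}" if "j < n" for j
    proof
      assume "r < card (\<omega> j)"
      then show "\<omega> j = {..<m}" using fin(2)[OF that] 2 by (intro full that) linarith
    qed (simp add: 2)
    then have big: "{j. j < n \<and> r < card (\<omega> j)} = A" unfolding A_def by blast
    \<comment> \<open>Each full column has excess 1 and the others none, so equality for all rows
      says that there are exactly \<open>r\<close> full columns.\<close>
    have "int r = (\<Sum>j<n. max (int (card (\<omega> j)) - int r) 0)" using total 2 by simp
    also have "\<dots> = (\<Sum>j\<in>A. max (int (card (\<omega> j)) - int r) 0)"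
      unfolding big[symmetric] by (intro sum.mono_neutral_right) auto
    also have "\<dots> = (\<Sum>j\<in>A. 1)"
      by (rule sum.cong) (simp_all add: A_def 2)
    finally have "card A = r" by simp
    then obtain h where h: "bij_betw h {..<r} A"
      using ex_bij_betw_nat_finite[OF finA] by (auto simp: atLeast0LessThan)
    show ?thesis
    proof (rule SLMF_partition_of_blocks[OF assms(1,3)])
      show "disjoint_family_on (\<lambda>l. {h l}) {..<r}"
        using h by (auto simp: disjoint_family_on_def bij_betw_def inj_on_def)
      show "(\<Union>l<r. {h l}) = {j. j < n \<and> r < card (\<omega> j)}"
        using h by (auto simp: big bij_betw_def)
      fix l J assume "l < r" "finite J" "{h l} \<subseteq> J"
        "\<And>j. j \<in> J - {h l} \<Longrightarrow> finite (\<omega> j) \<and> card (\<omega> j) \<le> r"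
      moreover from \<open>l < r\<close> have "h l \<in> A" using h by (auto simp: bij_betw_def)
      ultimately show "relaxed_SLMF 1 r m \<omega> J"
        using 2 by (intro relaxed_SLMF_full_column[of J "h l"]) (auto simp: A_def)
    qed
  next
    case 3
    define N where "N = {j. j < n \<and> card (\<omega> j) = r + 1}"
    \<comment> \<open>The row missing from a column of \<open>N\<close>.\<close>
    define \<mu> where "\<mu> = (\<lambda>j. SOME i. i < m \<and> \<omega> j = {..<m} - {i})"
    have finN: "finite N" by (simp add: N_def)
    have \<mu>: "\<mu> j < m \<and> \<omega> j = {..<m} - {\<mu> j}" if "j \<in> N" for j
      unfolding \<mu>_def
    proof (rule someI_ex)
      have "card ({..<m} - \<omega> j) = 1"
        using that assms(3) fin 3 by (subst card_Diff_subset) (auto simp: N_def)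
      then obtain i where "{..<m} - \<omega> j = {i}" by (auto simp: card_1_singleton_iff)
      then show "\<exists>i. i < m \<and> \<omega> j = {..<m} - {i}"
        using that assms(3) by (intro exI[of _ i]) (auto simp: N_def)
    qed
    have cardA: "card (\<omega> j) = r + 2" if "j \<in> A" for j using that 3 by (simp add: A_def)
    have "r < card (\<omega> j) \<longleftrightarrow> \<omega> j = {..<m} \<or> card (\<omega> j) = r + 1" if "j < n" for j
    proof
      assume "r < card (\<omega> j)"
      then have "card (\<omega> j) = m \<or> card (\<omega> j) = r + 1" using fin(2)[OF that] 3 by linarith
      then show "\<omega> j = {..<m} \<or> card (\<omega> j) = r + 1" using full[OF that] by blast
    next
      assume "\<omega> j = {..<m} \<or> card (\<omega> j) = r + 1"
      then show "r < card (\<omega> j)" using 3 by (elim disjE) simp_all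
    qed
    then have big: "{j. j < n \<and> r < card (\<omega> j)} = A \<union> N" unfolding A_def N_def by blast
    have disj: "A \<inter> N = {}" using cardA by (auto simp: N_def)
    have "2 * int r = (\<Sum>j<n. max (int (card (\<omega> j)) - int r) 0)" using total 3 by simp
    also have "\<dots> = (\<Sum>j\<in>A \<union> N. max (int (card (\<omega> j)) - int r) 0)"
      unfolding big[symmetric] by (intro sum.mono_neutral_right) auto
    also have "\<dots> = (\<Sum>j\<in>A. 2) + (\<Sum>j\<in>N. 1)"
      using disj finA finN by (simp add: sum.union_disjoint cardA N_def)
    finally have count: "2 * card A + card N = 2 * r" by simp
    \<comment> \<open>In the inequality for all rows but \<open>i\<close>, the full columns and the
      columns missing exactly \<open>i\<close> have excess 1 each, and the right side is
      \<open>r\<close>.\<close>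
    have count_i: "card A + card {j\<in>N. \<mu> j = i} \<le> r" if i: "i < m" for i
    proof -
      let ?I = "{..<m} - {i}"
      have "int (card (A \<union> {j\<in>N. \<mu> j = i})) = (\<Sum>j\<in>A \<union> {j\<in>N. \<mu> j = i}. max (int (card (\<omega> j \<inter> ?I)) - int r) 0)"
      proof -
        have "\<omega> j \<inter> ?I = ?I" if "j \<in> A \<union> {j\<in>N. \<mu> j = i}" for j
          using that \<mu> by (auto simp: A_def)
        then show ?thesis using 3 i by simp
      qed
      also have "\<dots> \<le> (\<Sum>j<n. max (int (card (\<omega> j \<inter> ?I)) - int r) 0)"
        by (rule sum_mono2) (auto simp: A_def N_def)
      also have "\<dots> \<le> int r * (int (card ?I) - int r)"
      proof -
        have "?I \<subseteq> {..<m} \<and> r + 1 \<le> card ?I" using i 3 by auto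
        then show ?thesis using slmf unfolding relaxed_SLMF_def by blast
      qed
      also have "\<dots> = int r" using i 3 by simp
      finally have "card (A \<union> {j\<in>N. \<mu> j = i}) \<le> r" by simp
      moreover have "card (A \<union> {j\<in>N. \<mu> j = i}) = card A + card {j\<in>N. \<mu> j = i}"
        using disj finA finN by (intro card_Un_disjoint) auto
      ultimately show ?thesis by simp
    qed
    \<comment> \<open>The number of pairs formed from \<open>N\<close>; no row is missing from more
      than \<open>s\<close> columns of \<open>N\<close>, as the pairing requires.\<close>
    define s where "s = r - card A"
    have s: "r = s + card A" "card N = 2 * s" using count by (auto simp: s_def)
    have "card {j\<in>N. \<mu> j = i} \<le> s" for i
    proof (cases "i < m")
      case True then show ?thesis using count_i[of i] s by simp
    next
      case False
      then have "{j\<in>N. \<mu> j = i} = {}" using \<mu> by blast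
      then show ?thesis by (simp only: card.empty)
    qed
    then obtain xs where xs: "distinct xs" "set xs = N" "length xs = 2 * s"
      "\<And>l. l < s \<Longrightarrow> \<mu> (xs ! l) \<noteq> \<mu> (xs ! (l + s))"
      using sorted_list_pairing[OF finN s(2)] by blast
    obtain h where h: "bij_betw h {..<card A} A"
      using ex_bij_betw_nat_finite[OF finA] by (auto simp: atLeast0LessThan)
    \<comment> \<open>The first \<open>s\<close> blocks are pairs of columns missing different rows;
      the other \<open>card A\<close> blocks are single full columns.\<close>
    define B where "B = (\<lambda>l. if l < s then {xs ! l, xs ! (l + s)} else {h (l - s)})"
    have xsN: "xs ! l \<in> N" if "l < 2 * s" for l using that xs by (metis nth_mem)
    have hA: "h (l - s) \<in> A" if "l < r" "\<not> l < s" for l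
      using that h s by (auto simp: bij_betw_def)
    show ?thesis
    proof (rule SLMF_partition_of_blocks[OF assms(1,3)])
      show "disjoint_family_on B {..<r}"
        unfolding disjoint_family_on_def
      proof (intro ballI impI)
        fix l l' assume l: "l \<in> {..<r}" "l' \<in> {..<r}" "l \<noteq> l'"
        consider "l < s" "l' < s" | "l < s" "\<not> l' < s" | "\<not> l < s" "l' < s" | "\<not> l < s" "\<not> l' < s"
          by blast
        then show "B l \<inter> B l' = {}"
        proof cases
          case 1
          then show ?thesis using l(3) xs(1,3) by (auto simp: B_def nth_eq_iff_index_eq)
        next
          case 2
          have "xs ! l \<in> N" "xs ! (l + s) \<in> N" "h (l' - s) \<in> A" using xsN hA l 2 by auto
          then show ?thesis using disj 2 by (auto simp: B_def)
        next
          case 3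
          have "xs ! l' \<in> N" "xs ! (l' + s) \<in> N" "h (l - s) \<in> A" using xsN hA l 3 by auto
          then show ?thesis using disj 3 by (auto simp: B_def)
        next
          case 4
          then have "l - s < card A" "l' - s < card A" "l - s \<noteq> l' - s" using l s by auto
          then have "h (l - s) \<noteq> h (l' - s)" using h by (auto simp: bij_betw_def inj_on_def)
          then show ?thesis using 4 by (simp add: B_def)
        qed
      qed
      show "(\<Union>l<r. B l) = {j. j < n \<and> r < card (\<omega> j)}"
        unfolding big
      proof
        show "(\<Union>l<r. B l) \<subseteq> A \<union> N"
          using xsN hA by (auto simp: B_def)
        show "A \<union> N \<subseteq> (\<Union>l<r. B l)"
        proof
          fix j assume "j \<in> A \<union> N"
          then show "j \<in> (\<Union>l<r. B l)"
          proof
            assume "j \<in> A"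
            then obtain l where "l < card A" "j = h l" using h by (auto simp: bij_betw_def)
            then show ?thesis using s by (intro UN_I[of "l + s"]) (auto simp: B_def)
          next
            assume "j \<in> N"
            then obtain k where k: "k < 2 * s" "j = xs ! k" using xs by (metis in_set_conv_nth)
            show ?thesis
            proof (cases "k < s")
              case True then show ?thesis using s k by (intro UN_I[of k]) (auto simp: B_def)
            next
              case False then show ?thesis using s k by (intro UN_I[of "k - s"]) (auto simp: B_def)
            qed
          qed
        qed
      qed
      fix l J assume lJ: "l < r" "finite J" "B l \<subseteq> J"
        "\<And>j. j \<in> J - B l \<Longrightarrow> finite (\<omega> j) \<and> card (\<omega> j) \<le> r"
      show "relaxed_SLMF 1 r m \<omega> J"
      proof (cases "l < s")
        case True
        then have "xs ! l \<in> N" "xs ! (l + s) \<in> N" "xs ! l \<noteq> xs ! (l + s)"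
          using xsN xs(4)[of l] by auto
        then show ?thesis
          using lJ True \<mu> xs(4)[of l] 3
          by (intro relaxed_SLMF_two_columns[of J "xs ! l" "xs ! (l + s)" m r \<omega> "\<mu> (xs ! l)" "\<mu> (xs ! (l + s))"])
            (auto simp: B_def)
      next
        case False
        then show ?thesis
          using lJ hA[of l] 3
          by (intro relaxed_SLMF_full_column[of J "h (l - s)"]) (auto simp: B_def A_def)
      qed
    qed
  qed
qed

section \<open>The algebraic matroid\<close>

lemma point_val_cong:
  assumes "p \<in> carrier (mpoly_ring V)" "\<And>v. v \<in> V \<Longrightarrow> x v = y v"
  shows "point_val x p = point_val y p"
  unfolding peval_def mono_val_def
  using assms by (intro sum.cong refl arg_cong2[of _ _ _ _ "(*)"] prod.cong arg_cong2[of _ _ _ _ "(^)"])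
    (auto simp: mpoly_ring_carrier_iff)

text \<open>Varying both factors of a matrix of rank at most \<open>r\<close> linearly in \<epsilon>
  gives curves of such matrices. By \<open>peelable_solvable\<close> their velocity on the support
  can be any \<open>X\<close>, so \<open>vanishing_along_curves\<close> applies.\<close>

lemma partition_imp_indep:
  fixes P :: "nat \<Rightarrow> nat set"
  assumes inf: "infinite (UNIV :: 'k::field set)" and "0 < r" "r = 1 \<or> m \<le> r + 2"
    and \<omega>: "\<forall>j<n. \<omega> j \<subseteq> {..<m}"
    and cover: "(\<Union>l<r. P l) = {..<n}" and slmf: "\<forall>l<r. relaxed_SLMF 1 r m \<omega> (P l)"
  shows "det_matroid_indep TYPE('k) r m n (col_support \<omega> {..<n})"
  unfolding det_matroid_indep_iff
proof (intro conjI allI impI)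
  show "col_support \<omega> {..<n} \<subseteq> grid m n" using \<omega> by (auto simp: col_support_def)
  fix p :: "(nat \<times> nat, 'k) mpoly"
  assume p: "p \<in> carrier (mpoly_ring (col_support \<omega> {..<n})) \<and> p \<in> det_ideal r m n"
  obtain t :: "nat \<Rightarrow> 'k" where t: "inj t" using infinite_countable_subset[OF inf] by blast
  have "\<forall>j\<in>{..<n}. \<exists>l. l < r \<and> j \<in> P l" using cover by blast
  from bchoice[OF this] obtain block where block: "\<And>j. j < n \<Longrightarrow> block j < r \<and> j \<in> P (block j)" by auto
  \<comment> \<open>The Vandermonde matrix of \<open>t\<close> times the 0-1 matrix whose column
    \<open>j\<close> has its only 1 in row \<open>block j\<close>.\<close>
  define M where "M = (\<lambda>(i, j). t i ^ block j)"
  show "p = 0"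
  proof (rule point_val_identity[OF inf], rule vanishing_along_curves[OF inf])
    fix X :: "nat \<times> nat \<Rightarrow> 'k"
    have "\<forall>l\<in>{..<r}. \<exists>uw. \<forall>j\<in>P l. degree (snd uw j) < r \<and>
        (\<forall>i\<in>\<omega> j \<inter> {..<m}. X (i, j) = fst uw i + poly (snd uw j) (t i))"
    proof
      fix l assume l: "l \<in> {..<r}"
      have "finite (P l)" using cover l finite_subset[of "P l" "{..<n}"] by blast
      then have "\<exists>u w. \<forall>j\<in>P l. degree (w j) < r \<and> (\<forall>i\<in>\<omega> j \<inter> {..<m}. X (i, j) = u i + poly (w j) (t i))"
        using relaxed_SLMF_peelable[of r m \<omega> "P l"] slmf l assms(2,3)
        by (intro peelable_solvable t) auto
      then show "\<exists>uw. \<forall>j\<in>P l. degree (snd uw j) < r \<and>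
          (\<forall>i\<in>\<omega> j \<inter> {..<m}. X (i, j) = fst uw i + poly (snd uw j) (t i))"
        by (metis fst_conv snd_conv)
    qed
    from bchoice[OF this] obtain uw where uw: "\<And>l j. l < r \<Longrightarrow> j \<in> P l \<Longrightarrow> degree (snd (uw l) j) < r"
      "\<And>l i j. l < r \<Longrightarrow> j \<in> P l \<Longrightarrow> i \<in> \<omega> j \<Longrightarrow> i < m \<Longrightarrow>
        X (i, j) = fst (uw l) i + poly (snd (uw l) j) (t i)"
      by auto
    define u where "u = (\<lambda>l. fst (uw l))"
    define w where "w = (\<lambda>j. snd (uw (block j)) j)"
    \<comment> \<open>The product of the two variations, which is the second-order term of the
      product of the varied factors.\<close>
    define Q where "Q = (\<lambda>(i, j). \<Sum>l<r. u l i * coeff (w j) l)"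
    show "\<exists>Q. \<forall>\<epsilon>. point_val (\<lambda>v. M v + \<epsilon> * X v + \<epsilon>\<^sup>2 * Q v) p = 0"
    proof (intro exI[of _ Q] allI)
      fix \<epsilon>
      let ?U = "\<lambda>i l. t i ^ l + \<epsilon> * u l i" and ?W = "\<lambda>l j. of_bool (l = block j) + \<epsilon> * coeff (w j) l"
      have "point_val (\<lambda>v. M v + \<epsilon> * X v + \<epsilon>\<^sup>2 * Q v) p =
          point_val (\<lambda>(i, j). \<Sum>l<r. ?U i l * ?W l j) p"
      \<comment> \<open>The polynomial involves only variables of the support, and agreement of the
        two matrices is checked there.\<close>
      proof (rule point_val_cong)
        show "p \<in> carrier (mpoly_ring (col_support \<omega> {..<n}))" using p by blast
        fix v assume "v \<in> col_support \<omega> {..<n}"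
        then obtain i j where v: "v = (i, j)" "j < n" "i \<in> \<omega> j" by (auto simp: col_support_def)
        then have "i < m" using \<omega> by blast
        have labj: "block j < r" "j \<in> P (block j)" using block v by auto
        have "poly (w j) (t i) = (\<Sum>l<r. coeff (w j) l * t i ^ l)"
          unfolding poly_altdef using uw(1)[OF labj]
          by (intro sum.mono_neutral_left) (auto simp: w_def coeff_eq_0)
        then have X: "X v = u (block j) i + (\<Sum>l<r. coeff (w j) l * t i ^ l)"
          using uw(2)[OF labj v(3) \<open>i < m\<close>] v by (simp add: u_def w_def)
        have "(\<Sum>l<r. ?U i l * ?W l j) = (\<Sum>l<r. (t i ^ l + \<epsilon> * u l i) * of_bool (l = block j)) +
            \<epsilon> * (\<Sum>l<r. coeff (w j) l * t i ^ l) + \<epsilon>\<^sup>2 * (\<Sum>l<r. u l i * coeff (w j) l)"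
          by (simp add: algebra_simps sum.distrib sum_distrib_left power2_eq_square)
        also have "(\<Sum>l<r. (t i ^ l + \<epsilon> * u l i) * of_bool (l = block j)) = t i ^ block j + \<epsilon> * u (block j) i"
          using labj by (simp add: of_bool_def if_distrib cong: if_cong)
        finally show "M v + \<epsilon> * X v + \<epsilon>\<^sup>2 * Q v = (case v of (i, j) \<Rightarrow> \<Sum>l<r. ?U i l * ?W l j)"
          using v X by (simp add: M_def Q_def algebra_simps)
      qed
      also have "\<dots> = 0" by (rule det_ideal_vanishes[OF conjunct2[OF p]])
      finally show "point_val (\<lambda>v. M v + \<epsilon> * X v + \<epsilon>\<^sup>2 * Q v) p = 0" .
    qed
  qed
qed

section \<open>From independence to the inequalities\<close>

text \<open>A larger intersection would satisfy a nonzero relation by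
  \<open>det_ideal_elimination\<close>. The whole grid gives maximality of bases, smaller rectangles
  the SLMF inequalities.\<close>

lemma indep_card_le:
  assumes "det_matroid_indep TYPE('k::field) r m n \<Omega>"
    and "S \<subseteq> {..<m}" "T \<subseteq> {..<n}" "r \<le> card S" "r \<le> card T"
  shows "card (\<Omega> \<inter> S \<times> T) \<le> r * (card S + card T - r)"
proof (rule ccontr)
  assume "\<not> ?thesis"
  then obtain p :: "(nat \<times> nat, 'k) mpoly"
    where p: "p \<in> carrier (mpoly_ring (\<Omega> \<inter> S \<times> T))" "p \<in> det_ideal r m n" "p \<noteq> 0"
    using det_ideal_elimination[OF assms(2-5), of "\<Omega> \<inter> S \<times> T"] by auto
  then have "p \<in> carrier (mpoly_ring \<Omega>)" by (auto simp: mpoly_ring_carrier_iff)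
  with p assms(1) show False unfolding det_matroid_indep_iff by blast
qed

text \<open>No independent set exceeds this cardinality, so an independent set attaining it is
  maximal.\<close>

lemma base_iff_indep:
  assumes "card \<Omega> = r * (m + n - r)" "r \<le> m" "r \<le> n"
  shows "det_matroid_base TYPE('k::field) r m n \<Omega> \<longleftrightarrow> det_matroid_indep TYPE('k) r m n \<Omega>"
proof -
  have "\<Omega>' = \<Omega>" if "det_matroid_indep TYPE('k) r m n \<Omega>'" "\<Omega> \<subseteq> \<Omega>'" for \<Omega>'
  proof -
    have grid: "\<Omega>' \<subseteq> grid m n" using that(1) by (simp add: det_matroid_indep_def)
    then have "finite \<Omega>'" using finite_subset by blast
    moreover have "card \<Omega>' \<le> card \<Omega>"
      using indep_card_le[OF that(1), of "{..<m}" "{..<n}"] assms grid by (simp add: Int_absorb2)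
    ultimately show ?thesis using that(2) card_seteq by metis
  qed
  then show ?thesis unfolding det_matroid_base_def by blast
qed

lemma card_col_support:
  assumes "finite J" "\<And>j. j \<in> J \<Longrightarrow> finite (\<omega> j)"
  shows "card (col_support \<omega> J) = (\<Sum>j\<in>J. card (\<omega> j))"
proof -
  have "card (col_support \<omega> J) = (\<Sum>j\<in>J. card (\<omega> j \<times> {j}))"
    unfolding col_support_def using assms by (intro card_UN_disjoint) auto
  then show ?thesis by (simp add: card_cartesian_product)
qed

text \<open>Only the columns \<open>T\<close> with more than \<open>r\<close> entries in
  \<open>I\<close> count. If there are at least \<open>r\<close> of them, the bound for the
  rectangle \<open>I \<times> T\<close>, less \<open>r * card T\<close>, is the inequality; fewer
  than \<open>r\<close> columns have excess at most \<open>card I - r\<close> each.\<close>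

lemma indep_imp_relaxed_SLMF:
  assumes r: "r < m" "m \<le> n" and \<omega>: "\<forall>j<n. \<omega> j \<subseteq> {..<m}"
    and card: "card (col_support \<omega> {..<n}) = r * (m + n - r)"
    and indep: "det_matroid_indep TYPE('k::field) r m n (col_support \<omega> {..<n})"
  shows "relaxed_SLMF r r m \<omega> {..<n}"
proof -
  have fin: "finite (\<omega> j)" if "j < n" for j
    using that \<omega> finite_subset[of "\<omega> j" "{..<m}"] by blast
  have upper: "(\<Sum>j<n. max (int (card (\<omega> j \<inter> I)) - int r) 0) \<le> int r * (int (card I) - int r)"
    if I: "I \<subseteq> {..<m}" "r + 1 \<le> card I" for I
  proof -
    define T where "T = {j. j < n \<and> r < card (\<omega> j \<inter> I)}"
    have finT: "finite T" "T \<subseteq> {..<n}" by (auto simp: T_def)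
    have finI: "finite I" using I finite_subset by auto
    have eq: "(\<Sum>j<n. max (int (card (\<omega> j \<inter> I)) - int r) 0) = (\<Sum>j\<in>T. int (card (\<omega> j \<inter> I)) - int r)"
      by (rule sum.mono_neutral_cong_right) (auto simp: T_def)
    show ?thesis
    proof (cases "r \<le> card T")
      case True
      have "col_support \<omega> {..<n} \<inter> I \<times> T = col_support (\<lambda>j. \<omega> j \<inter> I) T"
        using finT by (auto simp: col_support_def)
      then have "card (col_support \<omega> {..<n} \<inter> I \<times> T) = (\<Sum>j\<in>T. card (\<omega> j \<inter> I))"
        using finI finT by (simp add: card_col_support)
      then have "(\<Sum>j\<in>T. card (\<omega> j \<inter> I)) \<le> r * (card I + card T - r)"
        using indep_card_le[OF indep I(1) finT(2) _ True] I(2) by simp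
      then have "int (\<Sum>j\<in>T. card (\<omega> j \<inter> I)) \<le> int (r * (card I + card T - r))" by (rule zle_int[THEN iffD2])
      then have "(\<Sum>j\<in>T. int (card (\<omega> j \<inter> I))) \<le> int r * (int (card I) + int (card T) - int r)"
        using True by (simp add: of_nat_diff)
      then show ?thesis unfolding eq by (simp add: sum_subtractf algebra_simps)
    next
      case False
      have "(\<Sum>j\<in>T. int (card (\<omega> j \<inter> I)) - int r) \<le> (\<Sum>j\<in>T. int (card I) - int r)"
        using finI by (intro sum_mono) (simp add: card_mono)
      also have "\<dots> = int (card T) * (int (card I) - int r)" by simp
      also have "\<dots> \<le> int r * (int (card I) - int r)"
        using False I by (intro mult_right_mono) auto
      finally show ?thesis unfolding eq .
    qed
  qed
  \<comment> \<open>For equality at all rows, replacing each excess by the possibly negative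
    \<open>card (\<omega> j) - r\<close> gives a lower bound that the cardinality of the support
    evaluates.\<close>
  have "int r * (int m - int r) = int (r * (m + n - r)) - int r * int n"
  proof -
    have eq: "int (m + n - r) = int m + int n - int r" using r by simp
    show ?thesis unfolding of_nat_mult eq by (simp add: algebra_simps)
  qed
  also have "\<dots> = (\<Sum>j<n. int (card (\<omega> j)) - int r)"
  proof -
    have "(\<Sum>j<n. card (\<omega> j)) = r * (m + n - r)"
      using card_col_support[of "{..<n}" \<omega>] fin card by simp
    then have "int (r * (m + n - r)) = (\<Sum>j<n. int (card (\<omega> j)))" by (metis of_nat_sum)
    then show ?thesis by (simp only: sum_subtractf) (simp add: mult.commute)
  qed
  also have "\<dots> \<le> (\<Sum>j<n. max (int (card (\<omega> j \<inter> {..<m})) - int r) 0)"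
  proof (rule sum_mono)
    fix j assume "j \<in> {..<n}"
    then have "\<omega> j \<inter> {..<m} = \<omega> j" using \<omega> by blast
    then show "int (card (\<omega> j)) - int r \<le> max (int (card (\<omega> j \<inter> {..<m})) - int r) 0" by simp
  qed
  finally have lower: "int r * (int m - int r) \<le> (\<Sum>j<n. max (int (card (\<omega> j \<inter> {..<m})) - int r) 0)" .
  show ?thesis
    unfolding relaxed_SLMF_def using upper upper[of "{..<m}"] lower r by auto
qed

theorem proposition2:
  fixes r m n :: nat and \<omega> :: "nat \<Rightarrow> nat set"
  assumes "infinite (UNIV :: 'k::field set)"
    and "0 < r" and "r < m" and "m \<le> n"
    and "r = 1 \<or> m = r + 1 \<or> m = r + 2"
    and "\<forall>j<n. \<omega> j \<subseteq> {..<m}"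
    and "card (col_support \<omega> {..<n}) = r * (m + n - r)"
  shows
    "((\<exists>P :: nat \<Rightarrow> nat set. disjoint_family_on P {..<r} \<and> (\<Union>l<r. P l) = {..<n} \<and>
         (\<forall>l<r. relaxed_SLMF 1 r m \<omega> (P l)))
      \<longleftrightarrow> relaxed_SLMF r r m \<omega> {..<n})
     \<and> (det_matroid_base TYPE('k) r m n (col_support \<omega> {..<n}) \<longleftrightarrow>
       (\<exists>P :: nat \<Rightarrow> nat set. disjoint_family_on P {..<r} \<and> (\<Union>l<r. P l) = {..<n} \<and>
         (\<forall>l<r. relaxed_SLMF 1 r m \<omega> (P l))))"
    (is "(?a \<longleftrightarrow> ?b) \<and> (?base \<longleftrightarrow> ?a)")
proof -
  have base: "?base \<longleftrightarrow> det_matroid_indep TYPE('k) r m n (col_support \<omega> {..<n})"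
    using assms by (intro base_iff_indep) auto
  have "?a \<Longrightarrow> ?base"
    unfolding base using partition_imp_indep[OF assms(1,2) _ assms(6)] assms(5) by fastforce
  moreover have "?base \<Longrightarrow> ?b"
    unfolding base by (rule indep_imp_relaxed_SLMF[OF assms(3,4,6,7)])
  moreover have "?b \<Longrightarrow> ?a"
    by (rule relaxed_SLMF_imp_partition[OF assms(2,5,6)])
  ultimately show ?thesis by blast
qed

end
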